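(* Let $(b_h)_{h\ge0}$ be a sequence of positive reals with $\sup_h b_h<\infty$, and consider the weight function $w_0(h,t)=b_h$, $w_1(h,t)=1$ on $\mathbb Z_+^2$, with $\mathcal P=\mathcal P(w)$ and $\mathcal E=\{\pi(P):P\in\mathrm{ext}\,\mathcal P\}$. (1) If $\sum_h b_h<\infty$, then each $P_\theta$ with $\theta>\sup_h b_h$ is decomposable (i.e. not an extreme point of $\mathcal P$), and $$\mathrm{ext}\,\mathcal P=\{Q_{m,\infty}:\ b_m>b_j\text{ for }j<m\}\cup\{Q_{\infty,m}:\ m\ge0\};$$ then $\mathcal E$ is a discrete set with the only accumulation point at $\pi=1-b_0/(\sup_h b_h)$. (2) If $\sum_h b_h=\infty$, then $$\mathrm{ext}\,\mathcal P=\{Q_{m,\infty}:\ b_m>b_j\text{ for }j<m\}\cup\{P_\theta:\ \theta>\sup_h b_h\},$$ and $\mathcal E$ contains the interval $[1-b_0/(\sup_h b_h),\,1]$.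
   Context: Consider the lattice $\mathbb Z_+^2$ with directed edges $(h,t)\to(h+1,t)$ and $(h,t)\to(h,t+1)$, carrying strictly positive weights $w_1(h,t)$ and $w_0(h,t)$ respectively. A standard path starts at $(0,0)$ and moves along directed edges. The weight of a finite path is the product of the weights of its edges; $d(h,t)$ is the sum of the weights of all standard paths with endpoint $(h,t)$, and $d(h,t;h',t')$ is the sum of the weights of all paths from $(h,t)$ to $(h',t')$. $\mathcal P=\mathcal P(w)$ is the set of probability laws $P$ of random infinite standard paths $S=(S_n)_{n\ge0}$, $S_n=(H_n,T_n)$, $H_n+T_n=n$, that are Markov chains with the conditioning property: whenever $P(S_{h+t}=(h,t))>0$, given $S_{h+t}=(h,t)$ the conditional probability of each standard path with endpoint $(h,t)$ is the weight of that path divided by $d(h,t)$. $\mathcal P$ is convex; $\mathrm{ext}\,\mathcal P$ denotes its set of extreme points, and $\pi(P):=P(H_1=1)$ is the probability of a first head. The probability function of $P\in\mathcal P$ is $\phi(h,t)=P(S_{h+t}=(h,t))/d(h,t)$; it determines $P$. For the weights $w_0(h,t)=b_h$, $w_1(h,t)=1$ and $\theta>\sup_h b_h$, $P_\theta\in\mathcal P$ is the measure with probability function $$\phi_\theta(h,t)=\frac{(\theta-b_0)\cdots(\theta-b_{h-1})}{\theta^{h+t}},$$ i.e. the law of the Markov chain moving from $(h,t)$ to $(h+1,t)$ with probability $1-b_h/\theta$ and to $(h,t+1)$ with probability $b_h/\theta$. For $m\ge0$, $Q_{m,\infty}$ denotes (if it exists) the measure in $\mathcal P$ whose probability function is strictly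 positive on $\{(h,t):h\le m\}$ and zero otherwise, and which is induced by the path $(m,n-m)$, $n\to\infty$, meaning that its probability function is $\lim_{n\to\infty} d(h,t;m,n-m)/d(m,n-m)$. Likewise $Q_{\infty,m}$ denotes (if it exists) the measure in $\mathcal P$ whose probability function is strictly positive on $\{(h,t):t\le m\}$ and zero otherwise, and which is induced by the path $(n-m,m)$, $n\to\infty$.
   Formalization: In (2) the family P_θ, θ > sup b, is completed by its end members θ = sup b and θ = ∞ (the all-heads law), both extreme; without the latter the list is false and π = 1 is not in E. In (1), "discrete" means every point of E other than the accumulation point is isolated. *)

theory Defs
  imports "HOL-Probability.Probability"
begin

section \<open>Directed paths on the quarter-lattice and their weights\<close>

type_synonym vertex = "nat \<times> nat"

text \<open>A weight function gives the weight of the directed edge from its first to its second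
  argument; its values on pairs that are not edges are irrelevant.\<close>

type_synonym edge_weight = "vertex \<Rightarrow> vertex \<Rightarrow> real"

definition is_edge :: "vertex \<Rightarrow> vertex \<Rightarrow> bool" where
  "is_edge x y \<longleftrightarrow> y = (Suc (fst x), snd x) \<or> y = (fst x, Suc (snd x))"

text \<open>A finite path is the list of its vertices; the one-vertex path has weight 1.\<close>

definition paths :: "vertex \<Rightarrow> vertex \<Rightarrow> vertex list set" where
  "paths x y = {p. p \<noteq> [] \<and> hd p = x \<and> last p = y \<and> successively is_edge p}"

fun path_weight :: "edge_weight \<Rightarrow> vertex list \<Rightarrow> real" where
  "path_weight w [] = 1"
| "path_weight w [x] = 1"
| "path_weight w (x # y # p) = w x y * path_weight w (y # p)"

definition path_sum :: "edge_weight \<Rightarrow> vertex \<Rightarrow> vertex \<Rightarrow> real" where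
  "path_sum w x y = (\<Sum>p\<in>paths x y. path_weight w p)"

text \<open>The index sets of these sums are finite, so no sum is zero by convention.\<close>

lemma path_length:
  assumes "successively is_edge p" "p \<noteq> []"
  shows "length p + fst (hd p) + snd (hd p) = Suc (fst (last p) + snd (last p))"
  using assms
proof (induction p rule: induct_list012)
  case (3 x y zs)
  then show ?case by (auto simp: is_edge_def)
qed auto

lemma path_bounds:
  assumes "successively is_edge p" "z \<in> set p"
  shows "fst z \<le> fst (last p) \<and> snd z \<le> snd (last p)"
  using assms
proof (induction p arbitrary: z rule: induct_list012)
  case (3 x y zs)
  have *: "fst y \<le> fst (last (y # zs)) \<and> snd y \<le> snd (last (y # zs))"
    using 3(2)[of y] 3(3) by simp
  show ?case
  proof (cases "z = x")
    case True
    then show ?thesis using * 3(3) by (auto simp: is_edge_def)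
  next
    case False
    then show ?thesis using 3(2)[of z] 3(3,4) by simp
  qed
qed auto

lemma finite_paths: "finite (paths x y)"
proof (rule finite_subset)
  show "paths x y \<subseteq> {p. set p \<subseteq> {..fst y} \<times> {..snd y} \<and> length p \<le> Suc (fst y + snd y)}"
  proof
    fix p assume "p \<in> paths x y"
    then have p: "p \<noteq> []" "hd p = x" "last p = y" "successively is_edge p"
      by (auto simp: paths_def)
    have "set p \<subseteq> {..fst y} \<times> {..snd y}"
    proof
      fix z assume "z \<in> set p"
      from path_bounds[OF p(4) this] p(3) show "z \<in> {..fst y} \<times> {..snd y}"
        by (cases z) auto
    qed
    with path_length[OF p(4,1)] p(3)
    show "p \<in> {p. set p \<subseteq> {..fst y} \<times> {..snd y} \<and> length p \<le> Suc (fst y + snd y)}"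
      by auto
  qed
  show "finite {p. set p \<subseteq> {..fst y} \<times> {..snd y} \<and> length p \<le> Suc (fst y + snd y)}"
    by (rule finite_lists_length_le) auto
qed


section \<open>Markov laws with the conditioning property\<close>

type_synonym law = "(nat \<Rightarrow> vertex) measure"

definition path_space :: law where
  "path_space = (\<Pi>\<^sub>M n\<in>UNIV. count_space UNIV)"

definition standard_path :: "(nat \<Rightarrow> vertex) \<Rightarrow> bool" where
  "standard_path S \<longleftrightarrow> S 0 = (0, 0) \<and> (\<forall>n. is_edge (S n) (S (Suc n)))"

definition markov_chain :: "law \<Rightarrow> bool" where
  "markov_chain P \<longleftrightarrow>
     (\<forall>n s y. \<P>(S in P. \<forall>i\<le>n. S i = s i) > 0 \<longrightarrow>
        \<P>(S in P. S (Suc n) = y \<bar> \<forall>i\<le>n. S i = s i) = \<P>(S in P. S (Suc n) = y \<bar> S n = s n))"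

definition conditioning_property :: "edge_weight \<Rightarrow> law \<Rightarrow> bool" where
  "conditioning_property w P \<longleftrightarrow>
     (\<forall>h t. \<P>(S in P. S (h + t) = (h, t)) > 0 \<longrightarrow>
        (\<forall>p\<in>paths (0, 0) (h, t).
           \<P>(S in P. (\<forall>i<length p. S i = p ! i) \<bar> S (h + t) = (h, t))
             = path_weight w p / path_sum w (0, 0) (h, t)))"

definition laws :: "edge_weight \<Rightarrow> law set" where
  "laws w = {P. prob_space P \<and> sets P = sets path_space \<and> (AE S in P. standard_path S) \<and>
                markov_chain P \<and> conditioning_property w P}"

definition extreme_laws :: "edge_weight \<Rightarrow> law set" where
  "extreme_laws w = {P \<in> laws w. \<not> (\<exists>P\<^sub>1\<in>laws w. \<exists>P\<^sub>2\<in>laws w. \<exists>u. P\<^sub>1 \<noteq> P\<^sub>2 \<and> 0 < u \<and> u < 1 \<and>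
     (\<forall>A\<in>sets path_space. measure P A = u * measure P\<^sub>1 A + (1 - u) * measure P\<^sub>2 A))}"

definition first_head :: "law \<Rightarrow> real" where
  "first_head P = \<P>(S in P. fst (S 1) = 1)"

definition prob_fun :: "edge_weight \<Rightarrow> law \<Rightarrow> nat \<Rightarrow> nat \<Rightarrow> real" where
  "prob_fun w P h t = \<P>(S in P. S (h + t) = (h, t)) / path_sum w (0, 0) (h, t)"


section \<open>The special laws\<close>

definition has_prob_fun :: "edge_weight \<Rightarrow> (nat \<Rightarrow> nat \<Rightarrow> real) \<Rightarrow> law \<Rightarrow> bool" where
  "has_prob_fun w \<phi> P \<longleftrightarrow> P \<in> laws w \<and> (\<forall>h t. prob_fun w P h t = \<phi> h t)"

text \<open>The laws \<open>Q\<^sub>m\<^sub>,\<^sub>\<infinity>\<close> and \<open>Q\<^sub>\<infinity>\<^sub>,\<^sub>m\<close>. The truncated difference \<open>n - m\<close> only matters for \<open>n < m\<close>,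
  which does not affect the limits.\<close>

definition is_Q_left :: "edge_weight \<Rightarrow> nat \<Rightarrow> law \<Rightarrow> bool" where
  "is_Q_left w m P \<longleftrightarrow> P \<in> laws w \<and>
     (\<forall>h t. h \<le> m \<longrightarrow> prob_fun w P h t > 0) \<and>
     (\<forall>h t. \<not> h \<le> m \<longrightarrow> prob_fun w P h t = 0) \<and>
     (\<forall>h t. (\<lambda>n. path_sum w (h, t) (m, n - m) / path_sum w (0, 0) (m, n - m))
               \<longlonglongrightarrow> prob_fun w P h t)"

definition is_Q_right :: "edge_weight \<Rightarrow> nat \<Rightarrow> law \<Rightarrow> bool" where
  "is_Q_right w m P \<longleftrightarrow> P \<in> laws w \<and>
     (\<forall>h t. t \<le> m \<longrightarrow> prob_fun w P h t > 0) \<and>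
     (\<forall>h t. \<not> t \<le> m \<longrightarrow> prob_fun w P h t = 0) \<and>
     (\<forall>h t. (\<lambda>n. path_sum w (h, t) (n - m, m) / path_sum w (0, 0) (n - m, m))
               \<longlonglongrightarrow> prob_fun w P h t)"

definition Q_left :: "edge_weight \<Rightarrow> nat \<Rightarrow> law" where
  "Q_left w m = (THE P. is_Q_left w m P)"

definition Q_right :: "edge_weight \<Rightarrow> nat \<Rightarrow> law" where
  "Q_right w m = (THE P. is_Q_right w m P)"

text \<open>The weights \<open>w\<^sub>0 (h, t) = b h\<close> and \<open>w\<^sub>1 (h, t) = 1\<close>: an edge that increases the second
  coordinate has weight \<open>b h\<close>, an edge that increases the first one has weight 1.\<close>

definition b_weight :: "(nat \<Rightarrow> real) \<Rightarrow> edge_weight" where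
  "b_weight b x y = (if fst y = fst x then b (fst x) else 1)"

definition phi_theta :: "(nat \<Rightarrow> real) \<Rightarrow> real \<Rightarrow> nat \<Rightarrow> nat \<Rightarrow> real" where
  "phi_theta b \<theta> h t = (\<Prod>j<h. \<theta> - b j) / \<theta> ^ (h + t)"

definition P_theta :: "(nat \<Rightarrow> real) \<Rightarrow> real \<Rightarrow> law" where
  "P_theta b \<theta> = (THE P. has_prob_fun (b_weight b) (phi_theta b \<theta>) P)"

text \<open>The member \<open>\<theta> = \<infinity>\<close> of the family: the law of the path consisting of heads only.\<close>

definition phi_inf :: "nat \<Rightarrow> nat \<Rightarrow> real" where
  "phi_inf h t = (if t = 0 then 1 else 0)"

definition P_inf :: "(nat \<Rightarrow> real) \<Rightarrow> law" where
  "P_inf b = (THE P. has_prob_fun (b_weight b) phi_inf P)"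

lemma phi_theta_tendsto_phi_inf: "((\<lambda>\<theta>. phi_theta b \<theta> h t) \<longlongrightarrow> phi_inf h t) at_top"
proof -
  have inv: "((\<lambda>\<theta>::real. c / \<theta>) \<longlongrightarrow> 0) at_top" for c
    by (rule tendsto_divide_0[OF tendsto_const filterlim_at_top_imp_at_infinity[OF filterlim_ident]])
  have "((\<lambda>\<theta>. (\<Prod>j<h. 1 - b j / \<theta>) * (1 / \<theta>) ^ t) \<longlongrightarrow> (\<Prod>j<h. 1 - 0) * 0 ^ t) at_top"
    by (intro tendsto_intros inv)
  moreover have "\<forall>\<^sub>F \<theta> in at_top. (\<Prod>j<h. 1 - b j / \<theta>) * (1 / \<theta>) ^ t = phi_theta b \<theta> h t"
    using eventually_gt_at_top[of 0]
  proof eventually_elim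
    case (elim \<theta>)
    have "(\<Prod>j<h. 1 - b j / \<theta>) = (\<Prod>j<h. (\<theta> - b j) / \<theta>)"
      using elim by (intro prod.cong) (auto simp: field_simps)
    then show ?case
      by (simp add: phi_theta_def prod_dividef power_add power_divide)
  qed
  ultimately have "((\<lambda>\<theta>. phi_theta b \<theta> h t) \<longlongrightarrow> (\<Prod>j<h. 1 - 0) * 0 ^ t) at_top"
    by (rule Lim_transform_eventually)
  then show ?thesis by (cases t) (auto simp: phi_inf_def)
qed

end

theory Submission
  imports Defs
begin

text \<open>
  Laws in \<open>\<P>\<close> correspond to normalized nonnegative \<open>\<phi>\<close> with \<open>\<phi> h t = \<phi> (h+1) t + b\<^sub>h \<phi> h (t+1)\<close>, and
  extreme laws to minimal \<open>\<phi>\<close>, those whose harmonic minorants are their multiples. Such a \<open>\<phi>\<close> is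
  determined by the moment sequence \<open>\<phi> 0 t\<close>; the moments \<open>x\<^sup>t\<close> give \<open>x\<^sup>t \<Prod>\<^sub>j\<^sub><\<^sub>h (1 - b\<^sub>j x)\<close>, which is
  \<open>\<phi>\<^sub>\<theta>\<close> for \<open>x = 1/\<theta>\<close>.

  The sum \<open>d(h,t;H,T)\<close> is the complete homogeneous symmetric polynomial of degree \<open>T - t\<close> in
  \<open>b\<^sub>h, \<dots>, b\<^sub>H\<close>. Let \<open>h\<^sub>k\<close> be the one in \<open>b\<^sub>0, \<dots>, b\<^sub>H\<close>. In \<open>k\<close>, \<open>h\<^sub>k\<close> is log-concave and \<open>k! h\<^sub>k\<close> is log-convex,
  so \<open>h\<^sub>T\<^sub>-\<^sub>t / h\<^sub>T\<close> is close to \<open>x\<^sup>t\<close> with \<open>x = h\<^sub>T\<^sub>-\<^sub>1 / h\<^sub>T\<close>, uniformly in \<open>H\<close> as \<open>T\<close> grows, and also as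
  \<open>H\<close> grows if \<open>\<Sum> b\<^sub>j = \<infinity>\<close>. Averaging the Martin kernel over the position at time \<open>n\<close> therefore gives
  \<open>b\<^sub>0 \<phi> h (t+1) \<le> \<phi> h t\<close>, unless \<open>\<Sum> b\<^sub>j < \<infinity>\<close> and the path has finitely many tails with positive
  probability. A minimal \<open>\<phi>\<close> with this bound is an eigenfunction of the shift in \<open>t\<close>, hence of the
  form above; in the exceptional case it dominates a multiple of the function of some \<open>Q\<^sub>\<infinity>\<^sub>,\<^sub>m\<close>.
  Conversely, the same averaging shows that \<open>x\<^sup>t (x - y)\<^sup>2\<close> has nonnegative integral, which
  makes the point masses minimal.
\<close>


section \<open>Complete homogeneous symmetric polynomials\<close>

text \<open>A monomial of degree \<open>Suc k\<close> either avoids \<open>x\<close> or has a factor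
  \<open>x\<close>. The same recursion governs the first step of a lattice path: a head drops the
  variable, a tail multiplies by it and keeps it.\<close>

fun hsum :: "real list \<Rightarrow> nat \<Rightarrow> real" where
  "hsum xs 0 = 1"
| "hsum [] (Suc k) = 0"
| "hsum (x # xs) (Suc k) = hsum xs (Suc k) + x * hsum (x # xs) k"

lemma hsum_0 [simp]: "hsum xs 0 = 1"
  by (cases xs) auto

lemma hsum_Nil: "hsum [] k = (if k = 0 then 1 else 0)"
  by (cases k) auto

lemma hsum_singleton: "hsum [x] k = x ^ k"
  by (induction k) auto

lemma hsum_Suc_0: "hsum xs (Suc 0) = sum_list xs"
  by (induction xs) auto

lemma hsum_nonneg: "(\<And>x. x \<in> set xs \<Longrightarrow> x \<ge> 0) \<Longrightarrow> hsum xs k \<ge> 0"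
  by (induction xs k rule: hsum.induct) auto

lemma hsum_pos: "(\<And>x. x \<in> set xs \<Longrightarrow> x > 0) \<Longrightarrow> xs \<noteq> [] \<Longrightarrow> hsum xs k > 0"
proof (induction xs k rule: hsum.induct)
  case (3 x xs k)
  have "hsum xs (Suc k) \<ge> 0"
    using "3.prems" by (intro hsum_nonneg) (auto simp: less_imp_le)
  moreover have "x * hsum (x # xs) k > 0"
    using 3 by simp
  ultimately show ?case by simp
qed auto

text \<open>Symmetry of \<open>hsum\<close> in the form in which it is used: any variable, not only
  the first, can be split off. The outer induction is on the prefix \<open>us\<close>, the inner one
  on the degree.\<close>

lemma hsum_remove:
  "hsum (us @ y # vs) (Suc k) = hsum (us @ vs) (Suc k) + y * hsum (us @ y # vs) k"
proof (induction us arbitrary: k)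
  case (Cons u us)
  show ?case
  proof (induction k)
    case 0
    then show ?case by (simp add: Cons.IH[of 0])
  next
    case (Suc k)
    define U V M where "U = hsum (u # us @ y # vs) k"
      and "V = hsum (u # us @ vs) (Suc k)" and "M = hsum (us @ y # vs) (Suc k)"
    \<comment> \<open>Two evaluations of \<open>hsum (u # us @ y # vs) (Suc k)\<close>: the left
      splits off \<open>y\<close> by the inner hypothesis, the right splits off \<open>u\<close> by
      definition.\<close>
    have "V + y * U = M + u * U"
      using Suc by (simp add: U_def V_def M_def)
    then have V: "V = M + u * U - y * U" by simp
    have "hsum ((u # us) @ y # vs) (Suc (Suc k)) = hsum (us @ vs) (Suc (Suc k)) + y * M + u * (M + u * U)"
      using Cons.IH[of "Suc k"] by (simp add: U_def M_def)
    also have "\<dots> = hsum (us @ vs) (Suc (Suc k)) + u * V + y * (M + u * U)"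
      unfolding V by (simp add: algebra_simps)
    also have "\<dots> = hsum ((u # us) @ vs) (Suc (Suc k)) + y * hsum ((u # us) @ y # vs) (Suc k)"
      by (simp add: U_def V_def M_def)
    finally show ?case .
  qed
qed simp

lemma hsum_ge_power:
  assumes "\<And>x. x \<in> set xs \<Longrightarrow> x \<ge> 0" and "y \<in> set xs"
  shows "y ^ k \<le> hsum xs k"
proof (induction k)
  case (Suc k)
  from assms(2) obtain us vs where xs: "xs = us @ y # vs" by (auto simp: in_set_conv_decomp)
  have "0 \<le> hsum (us @ vs) (Suc k)" using assms(1) xs by (intro hsum_nonneg) auto
  moreover have "y * y ^ k \<le> y * hsum xs k" using Suc assms by (intro mult_left_mono) auto
  ultimately show ?case using hsum_remove[of us y vs k] xs by simp
qed simp

lemma hsum_append_mono: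
  assumes "\<And>x. x \<in> set (xs @ ys) \<Longrightarrow> x \<ge> 0"
  shows "hsum xs k \<le> hsum (xs @ ys) k"
  using assms
proof (induction xs k rule: hsum.induct)
  case (2 k)
  then show ?case using hsum_nonneg[of ys "Suc k"] by simp
next
  case (3 x xs k)
  then show ?case by (auto intro!: add_mono mult_left_mono)
qed simp

text \<open>Each monomial of degree \<open>k\<close> occurs in the expanded power with a coefficient
  of at least 1.\<close>

lemma hsum_le_power_sum_list:
  assumes "\<And>x. x \<in> set xs \<Longrightarrow> x \<ge> 0"
  shows "hsum xs k \<le> sum_list xs ^ k"
  using assms
proof (induction xs k rule: hsum.induct)
  case (3 x xs k)
  have x: "x \<ge> 0" and S: "sum_list xs \<ge> 0"
    using "3.prems" by (auto intro!: sum_list_nonneg)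
  have "hsum xs (Suc k) \<le> sum_list xs * sum_list xs ^ k"
    using 3 by auto
  also have "\<dots> \<le> sum_list xs * (x + sum_list xs) ^ k"
    using x S by (intro mult_left_mono power_mono) auto
  finally have "hsum xs (Suc k) \<le> sum_list xs * (x + sum_list xs) ^ k" .
  moreover have "x * hsum (x # xs) k \<le> x * (x + sum_list xs) ^ k"
    using 3 x by (intro mult_left_mono) auto
  ultimately show ?case by (simp add: algebra_simps)
qed auto

text \<open>Induction on the variables, comparing the values \<open>a\<close> before and
  \<open>A\<close> after a variable is added.\<close>

lemma hsum_log_concave:
  assumes "\<And>x. x \<in> set xs \<Longrightarrow> x > 0"
  shows "hsum xs k * hsum xs (Suc (Suc k)) \<le> hsum xs (Suc k) ^ 2"
  using assms
proof (induction xs arbitrary: k)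
  case Nil
  then show ?case by (simp add: hsum_Nil)
next
  case (Cons x xs)
  define A where "A = hsum (x # xs)"
  define a where "a = hsum xs"
  have x: "x > 0" using Cons.prems by simp
  have Apos: "A k > 0" for k
    unfolding A_def using Cons.prems by (intro hsum_pos) auto
  have anon: "a k \<ge> 0" for k
    unfolding a_def using Cons.prems by (intro hsum_nonneg) (auto simp: less_imp_le)
  have Arec: "A (Suc k) = a (Suc k) + x * A k" for k
    by (simp add: A_def a_def)
  have IH: "a k * a (Suc (Suc k)) \<le> a (Suc k) ^ 2" for k
    unfolding a_def using Cons by auto
  have zero: "A 0 = 1" "a 0 = 1" by (auto simp: A_def a_def)
  \<comment> \<open>Expanding one factor on each side of the claim by \<open>Arec\<close>, the terms
    with \<open>x\<close> cancel; so this mixed inequality is equivalent to log-concavity of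
    \<open>A\<close>.\<close>
  have *: "A k * a (Suc (Suc k)) \<le> A (Suc k) * a (Suc k)" for k
  proof (induction k)
    case 0
    have "0 \<le> x * a (Suc 0)" using x anon by simp
    then show ?case using IH[of 0] by (simp add: zero Arec power2_eq_square algebra_simps)
  next
    case (Suc k)
    have "A k * a (Suc (Suc (Suc k))) \<le> A (Suc k) * a (Suc (Suc k))"
    proof (cases "xs = []")
      case True
      then show ?thesis by (simp add: a_def)
    next
      case False
      have pos: "a (Suc k) > 0"
        unfolding a_def using Cons.prems False by (intro hsum_pos) auto
      have "a (Suc k) * (A k * a (Suc (Suc (Suc k)))) = A k * (a (Suc k) * a (Suc (Suc (Suc k))))"
        by simp
      also have "\<dots> \<le> A k * a (Suc (Suc k)) ^ 2"
        using IH[of "Suc k"] Apos[of k] by (intro mult_left_mono) auto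
      also have "\<dots> = (A k * a (Suc (Suc k))) * a (Suc (Suc k))"
        by (simp add: power2_eq_square)
      also have "\<dots> \<le> (A (Suc k) * a (Suc k)) * a (Suc (Suc k))"
        using Suc anon by (intro mult_right_mono) auto
      also have "\<dots> = a (Suc k) * (A (Suc k) * a (Suc (Suc k)))"
        by simp
      finally show ?thesis using pos by (simp only: mult_le_cancel_left_pos)
    qed
    then have "x * (A k * a (Suc (Suc (Suc k)))) \<le> x * (A (Suc k) * a (Suc (Suc k)))"
      using x by (intro mult_left_mono) auto
    then show ?case
      using IH[of "Suc k"]
      by (simp add: Arec[of k] Arec[of "Suc k"] power2_eq_square algebra_simps)
  qed
  have "A k * A (Suc (Suc k)) \<le> A (Suc k) ^ 2"
    using *[of k] by (simp add: Arec[of "Suc k"] Arec[of k] power2_eq_square algebra_simps)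
  then show ?case by (simp add: A_def)
qed

text \<open>For independent standard exponential \<open>X\<^sub>i\<close> one has \<open>k! h\<^sub>k(x) = E (\<Sum>x\<^sub>i X\<^sub>i)\<^sup>k\<close>, and moments
  are log-convex.\<close>

lemma hsum_log_convex:
  assumes "\<And>x. x \<in> set xs \<Longrightarrow> x > 0"
  shows "real (Suc k) * hsum xs (Suc k) ^ 2 \<le> real (Suc (Suc k)) * hsum xs k * hsum xs (Suc (Suc k))"
  using assms
proof (induction xs arbitrary: k)
  case Nil
  then show ?case by (simp add: hsum_Nil)
next
  case (Cons x xs)
  show ?case
  proof (cases "xs = []")
    case True
    have "x > 0" using Cons.prems by simp
    then show ?thesis unfolding True hsum_singleton
      by (simp add: power2_eq_square algebra_simps)
  next
    case False
    define A where "A = hsum (x # xs)"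
    define a where "a = hsum xs"
    have x: "x > 0" using Cons.prems by simp
    have Apos: "A k > 0" for k
      unfolding A_def using Cons.prems by (intro hsum_pos) auto
    have apos: "a k > 0" for k
      unfolding a_def using Cons.prems False by (intro hsum_pos) auto
    have Arec: "A (Suc k) = a (Suc k) + x * A k" for k
      by (simp add: A_def a_def)
    have IH: "real (Suc k) * a (Suc k) ^ 2 \<le> real (Suc (Suc k)) * a k * a (Suc (Suc k))" for k
      unfolding a_def using Cons by auto
    have zero: "A 0 = 1" "a 0 = 1" by (auto simp: A_def a_def)
    have lc: "A k * A (Suc (Suc k)) \<le> A (Suc k) ^ 2" for k
      unfolding A_def using Cons.prems by (intro hsum_log_concave) auto
    have "real (Suc k) * A (Suc k) ^ 2 \<le> real (Suc (Suc k)) * A k * A (Suc (Suc k))"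
    proof (induction k)
      case 0
      have "a (Suc 0) * a (Suc 0) \<le> x * x + 2 * a (Suc (Suc 0))"
        using IH[of 0] by (simp add: zero power2_eq_square add_increasing)
      then show ?case by (simp add: Arec zero power2_eq_square algebra_simps)
    next
      case (Suc k)
      define m where "m = real k + 2"
      have m: "real (Suc (Suc k)) = m" "real (Suc k) = m - 1" "real (Suc (Suc (Suc k))) = m + 1"
        by (auto simp: m_def)
      define z p q where "z = A k" and "p = A (Suc k)" and "q = A (Suc (Suc k))"
      define g where "g = a (Suc (Suc (Suc k)))"
      have al: "a (Suc k) = p - x * z" and be: "a (Suc (Suc k)) = q - x * p"
        by (auto simp: p_def q_def z_def Arec)
      have q3: "A (Suc (Suc (Suc k))) = g + x * q" by (simp add: Arec g_def q_def)
      have pz: "p > 0" "q > 0" using Apos by (auto simp: p_def q_def)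
      have alp: "p - x * z > 0" and bep: "q - x * p > 0" using apos al be by metis+
      have 1: "m * (q - x * p)\<^sup>2 \<le> (m + 1) * (p - x * z) * g"
        using IH[of "Suc k"] unfolding al be m g_def by simp
      have 2: "0 \<le> m * z * q - (m - 1) * p\<^sup>2"
        using Suc unfolding m z_def p_def q_def by simp
      have 3: "0 \<le> p\<^sup>2 - z * q"
        using lc[of k] unfolding z_def p_def q_def by simp
      \<comment> \<open>The claim, multiplied by \<open>p - x * z\<close> and with \<open>g\<close>
        replaced by its lower bound from \<open>1\<close>, reduces to this combination of the inner
        hypothesis \<open>2\<close> and of log-concavity \<open>3\<close>.\<close>
      have "0 \<le> x * ((q - x * p) * (m * z * q - (m - 1) * p\<^sup>2) + x * p * (p\<^sup>2 - z * q))"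
        using x bep 2 3 pz by (intro mult_nonneg_nonneg add_nonneg_nonneg) auto
      also have "\<dots> = p * (m * (q - x * p)\<^sup>2 + (m + 1) * x * q * (p - x * z)) - m * q\<^sup>2 * (p - x * z)"
        by (simp add: power2_eq_square algebra_simps)
      finally have "m * q\<^sup>2 * (p - x * z) \<le> p * (m * (q - x * p)\<^sup>2 + (m + 1) * x * q * (p - x * z))"
        by simp
      also have "\<dots> \<le> p * ((m + 1) * (p - x * z) * g + (m + 1) * x * q * (p - x * z))"
        using 1 pz by (intro mult_left_mono add_right_mono) auto
      also have "\<dots> = ((m + 1) * p * (g + x * q)) * (p - x * z)"
        by (simp add: algebra_simps)
      finally have "m * q\<^sup>2 \<le> (m + 1) * p * (g + x * q)"
        using alp by (simp only: mult_le_cancel_right_pos)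
      then show ?case unfolding m q3 unfolding p_def q_def .
    qed
    then show ?thesis by (simp add: A_def)
  qed
qed

section \<open>Laws and their cylinder probabilities\<close>

definition cyl :: "vertex list \<Rightarrow> (nat \<Rightarrow> vertex) set" where
  "cyl p = {S. \<forall>i<length p. S i = p ! i}"

definition std :: "vertex list \<Rightarrow> bool" where
  "std p \<longleftrightarrow> p \<noteq> [] \<and> hd p = (0, 0) \<and> successively is_edge p"

lemma length_std: "std p \<Longrightarrow> length p = Suc (fst (last p) + snd (last p))"
  using path_length[of p] by (auto simp: std_def)

section \<open>Path weights and the first-step decomposition\<close>

lemma paths_Cons:
  "paths x y = (if x = y then {[x]} else {}) \<union> (#) x ` paths (Suc (fst x), snd x) y
     \<union> (#) x ` paths (fst x, Suc (snd x)) y" (is "_ = ?R")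
proof (intro equalityI subsetI)
  fix p assume "p \<in> paths x y"
  then show "p \<in> ?R"
    by (cases p; cases "tl p") (auto simp: paths_def is_edge_def)
next
  fix p assume "p \<in> ?R"
  then show "p \<in> paths x y"
    by (auto simp: paths_def is_edge_def successively_Cons split: if_splits)
qed

lemma path_weight_Cons: "q \<noteq> [] \<Longrightarrow> path_weight w (x # q) = w x (hd q) * path_weight w q"
  by (cases q) auto

lemma path_weight_snoc: "p \<noteq> [] \<Longrightarrow> path_weight w (p @ [z]) = path_weight w p * w (last p) z"
  by (induction p rule: induct_list012) auto

lemma path_sum_rec:
  "path_sum w x y = (if x = y then 1 else 0)
     + w x (Suc (fst x), snd x) * path_sum w (Suc (fst x), snd x) y
     + w x (fst x, Suc (snd x)) * path_sum w (fst x, Suc (snd x)) y"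
proof -
  have *: "(\<Sum>p\<in>(#) x ` paths z y. path_weight w p) = w x z * path_sum w z y" for z
    unfolding path_sum_def sum_distrib_left
    by (subst sum.reindex) (auto simp: paths_def path_weight_Cons intro!: sum.cong)
  let ?z1 = "(Suc (fst x), snd x)" and ?z2 = "(fst x, Suc (snd x))"
  define A0 A1 A2 where "A0 = (if x = y then {[x]} else {})"
    and "A1 = (#) x ` paths ?z1 y" and "A2 = (#) x ` paths ?z2 y"
  have fin: "finite A0" "finite A1" "finite A2"
    by (simp_all add: A0_def A1_def A2_def finite_paths)
  have "A0 \<inter> A1 = {}" "(A0 \<union> A1) \<inter> A2 = {}"
    by (auto simp: A0_def A1_def A2_def paths_def)
  then have "path_sum w x y = sum (path_weight w) A0 + sum (path_weight w) A1 + sum (path_weight w) A2"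
    unfolding path_sum_def paths_Cons[of x y] A0_def[symmetric] A1_def[symmetric] A2_def[symmetric]
    using fin by (simp add: sum.union_disjoint)
  moreover have "sum (path_weight w) A0 = (if x = y then 1 else 0)" by (simp add: A0_def)
  ultimately show ?thesis unfolding A1_def A2_def * by simp
qed

lemma path_sum_eq_0:
  assumes "\<not> (fst x \<le> fst y \<and> snd x \<le> snd y)"
  shows "path_sum w x y = 0"
proof -
  have "p \<notin> paths x y" for p
    using path_bounds[of p x] assms by (auto simp: paths_def)
  then have "paths x y = {}" by blast
  then show ?thesis by (simp add: path_sum_def)
qed

section \<open>The sigma-algebra of path space and its generating cylinders\<close>

lemma space_path_space [simp]: "space path_space = UNIV"
  by (simp add: path_space_def space_PiM)

lemma sets_cyl [measurable]: "cyl p \<in> sets path_space"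
proof -
  have "{S \<in> space path_space. \<forall>i<length p. S i = p ! i} \<in> sets path_space"
    unfolding path_space_def by measurable
  then show ?thesis by (simp add: cyl_def)
qed

lemma sets_vertex [measurable]: "{S. S n \<in> A} \<in> sets path_space"
proof -
  have "{S \<in> space path_space. S n \<in> A} \<in> sets path_space"
    unfolding path_space_def by measurable
  then show ?thesis by simp
qed

text \<open>This makes the cylinders together with the empty set a generator that is stable under
  intersection.\<close>

lemma cyl_Int: "length p \<le> length q \<Longrightarrow> cyl p \<inter> cyl q = cyl q \<or> cyl p \<inter> cyl q = {}"
  by (cases "\<forall>i<length p. p ! i = q ! i") (auto simp: cyl_def)

text \<open>There are only countably many vertex lists, so an event about a single coordinate is a
  countable union of cylinders.\<close>

lemma sets_path_space_eq: "sets path_space = sigma_sets UNIV (insert {} (range cyl))"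
proof (intro equalityI)
  show "sigma_sets UNIV (insert {} (range cyl)) \<subseteq> sets path_space"
    using sets.sigma_sets_subset[of "insert {} (range cyl)" path_space] by (simp add: image_subset_iff sets_cyl)
  have "A \<in> sigma_sets UNIV (insert {} (range cyl))"
    if "A \<in> {{f \<in> \<Pi>\<^sub>E i\<in>UNIV. space (count_space UNIV). f i \<in> A} |i A. i \<in> UNIV \<and> A \<in> sets (count_space UNIV)}"
    for A :: "(nat \<Rightarrow> vertex) set"
  proof -
    from that obtain i B where A: "A = {f. f i \<in> B}" by auto
    have "A = (\<Union>p\<in>{p. length p = Suc i \<and> p ! i \<in> B}. cyl p)"
    proof (intro equalityI subsetI)
      fix S assume "S \<in> A"
      then show "S \<in> (\<Union>p\<in>{p. length p = Suc i \<and> p ! i \<in> B}. cyl p)"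
        by (intro UN_I[of "map S [0..<Suc i]"]) (auto simp: A cyl_def nth_append simp del: upt_Suc)
    qed (auto simp: A cyl_def)
    also have "\<dots> \<in> sigma_sets UNIV (insert {} (range cyl))"
      by (intro sigma_sets_UNION) (auto intro: sigma_sets.Basic)
    finally show ?thesis .
  qed
  then have "{{f. f i \<in> A} |i A. True} \<subseteq> sigma_sets UNIV (insert {} (range cyl))"
    by auto
  from sigma_sets_mono[OF this]
  have "sigma_sets UNIV {{f. f i \<in> A} |i A. True} \<subseteq> sigma_sets UNIV (insert {} (range cyl))" .
  moreover have "(\<Pi>\<^sub>E i\<in>(UNIV :: nat set). space (count_space (UNIV :: vertex set))) = UNIV"
    by (simp add: PiE_UNIV_domain)
  ultimately show "sets path_space \<subseteq> sigma_sets UNIV (insert {} (range cyl))"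
    unfolding path_space_def sets_PiM_single by simp
qed

text \<open>Dynkin's argument, stated for a mixture so that it serves twice: with weights 1 and 0 it
  shows that cylinders determine a law, and with weights \<open>u\<close> and \<open>1 - u\<close>
  it yields the convex decompositions in \<open>extreme_laws_iff\<close>.\<close>

lemma measure_eq_mixture:
  assumes P: "prob_space P" "sets P = sets path_space"
    and P1: "prob_space P1" "sets P1 = sets path_space"
    and P2: "prob_space P2" "sets P2 = sets path_space"
    and cyl: "\<And>p. measure P (cyl p) = u * measure P1 (cyl p) + v * measure P2 (cyl p)"
    and A: "A \<in> sets path_space"
  shows "measure P A = u * measure P1 A + v * measure P2 A"
proof -
  interpret P: prob_space P by fact
  interpret P1: prob_space P1 by fact
  interpret P2: prob_space P2 by fact
  have space: "space P = UNIV" "space P1 = UNIV" "space P2 = UNIV"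
    using P(2)[THEN sets_eq_imp_space_eq] P1(2)[THEN sets_eq_imp_space_eq] P2(2)[THEN sets_eq_imp_space_eq]
    by simp_all
  \<comment> \<open>The cylinder of the empty list is the whole space.\<close>
  have uv: "1 = u + v"
    using cyl[of "[]"] P.prob_space P1.prob_space P2.prob_space by (simp add: cyl_def space)
  have "cyl p \<inter> cyl q \<in> insert {} (range cyl)" for p q
    using cyl_Int[of p q] cyl_Int[of q p] by (cases "length p \<le> length q") (auto simp: Int_commute)
  then have int: "Int_stable (insert {} (range cyl))"
    unfolding Int_stable_def by (intro ballI) (elim insertE imageE; simp)
  have "insert {} (range cyl) \<subseteq> Pow UNIV" by simp
  from int this A[unfolded sets_path_space_eq] show ?thesis
  proof (induction rule: sigma_sets_induct_disjoint)
    case (basic A)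
    then show ?case using cyl by auto
  next
    case (compl A)
    then have A: "A \<in> sets path_space" by (simp add: sets_path_space_eq)
    then have eqs: "measure P (UNIV - A) = 1 - measure P A" "measure P1 (UNIV - A) = 1 - measure P1 A"
      "measure P2 (UNIV - A) = 1 - measure P2 A"
      using P.prob_compl[of A] P1.prob_compl[of A] P2.prob_compl[of A] P P1 P2 by (simp_all add: space)
    have v: "v = 1 - u" using uv by simp
    show ?case unfolding eqs compl(2) v by (simp add: algebra_simps)
  next
    case (union A)
    then have A: "range A \<subseteq> sets path_space" by (auto simp: sets_path_space_eq)
    have "(\<lambda>i. measure P (A i)) sums measure P (\<Union>i. A i)"
      using A union P by (intro P.finite_measure_UNION) auto
    moreover have "(\<lambda>i. u * measure P1 (A i) + v * measure P2 (A i)) sums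
        (u * measure P1 (\<Union>i. A i) + v * measure P2 (\<Union>i. A i))"
      using A union P1 P2
      by (intro sums_add sums_mult P1.finite_measure_UNION P2.finite_measure_UNION) auto
    ultimately show ?case using union by (simp add: sums_iff)
  qed auto
qed

lemma law_eqI:
  assumes P: "prob_space P" "sets P = sets path_space"
    and P1: "prob_space P1" "sets P1 = sets path_space"
    and "\<And>p. measure P (cyl p) = measure P1 (cyl p)"
  shows "P = P1"
proof (rule measure_eqI)
  interpret P: prob_space P by fact
  interpret P1: prob_space P1 by fact
  fix A assume "A \<in> sets P"
  then have "measure P A = measure P1 A"
    using measure_eq_mixture[OF P P1 P1, of 1 0 A] assms by simp
  then show "emeasure P A = emeasure P1 A"
    by (simp add: P.emeasure_eq_measure P1.emeasure_eq_measure)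
qed (simp add: P P1)

section \<open>Cylinder probabilities and membership in \<open>laws\<close>\<close>

lemma standard_path_in_paths:
  assumes "standard_path S" "S n = x"
  shows "map S [0..<Suc n] \<in> paths (0, 0) x"
proof -
  have "successively is_edge (map S [0..<Suc n])" for n
    using assms(1) by (induction n) (auto simp: standard_path_def successively_append_iff last_map)
  then show ?thesis
    using assms by (auto simp: paths_def standard_path_def hd_map last_map simp del: upt_Suc)
qed

lemma standard_path_cyl:
  assumes "standard_path S" "S \<in> cyl p" "p \<noteq> []"
  shows "std p"
proof -
  define q where "q = map S [0..<Suc (length p - 1)]"
  have "q \<in> paths (0, 0) (S (length p - 1))"
    unfolding q_def by (rule standard_path_in_paths[OF assms(1) refl])
  then have "std q" by (simp add: paths_def std_def)
  moreover have "q = p"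
    using assms by (intro nth_equalityI) (auto simp: q_def cyl_def simp del: upt_Suc)
  ultimately show ?thesis by simp
qed

lemma cyl_snoc: "cyl (p @ [z]) = {S \<in> cyl p. S (length p) = z}"
  by (auto simp: cyl_def nth_append less_Suc_eq)

lemma std_snoc: "std p \<Longrightarrow> std (p @ [z]) \<longleftrightarrow> is_edge (last p) z"
  by (auto simp: std_def successively_append_iff)

text \<open>Only the measure-theoretic part of membership in \<open>laws\<close> is kept, so that
  the locale also covers measures whose Markov and conditioning properties are still to be
  proved.\<close>

locale path_law = prob_space P for P :: law +
  assumes sets_P: "sets P = sets path_space" and AE_standard: "AE S in P. standard_path S"
begin

lemma space_P [simp]: "space P = UNIV"
  using sets_eq_imp_space_eq[OF sets_P] by simp

lemma prob_not_std:
  assumes "p \<noteq> []" "\<not> std p"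
  shows "prob (cyl p) = 0"
proof -
  from AE_standard have "AE S in P. S \<notin> cyl p"
    by eventually_elim (use standard_path_cyl assms in blast)
  then show ?thesis by (subst prob_eq_0) (simp_all add: sets_P sets_cyl)
qed

text \<open>Almost surely a path at \<open>(h, t)\<close> has followed exactly one standard path to
  that vertex, so the event splits into disjoint cylinders.\<close>

lemma prob_vertex_Int:
  assumes A: "A \<in> sets path_space"
  shows "prob ({S. S (h + t) = (h, t)} \<inter> A) = (\<Sum>p\<in>paths (0, 0) (h, t). prob (cyl p \<inter> A))"
proof -
  have len: "length p = Suc (h + t)" if "p \<in> paths (0, 0) (h, t)" for p
    using that path_length[of p] by (auto simp: paths_def)
  have "prob ({S. S (h + t) = (h, t)} \<inter> A) = prob (\<Union>p\<in>paths (0, 0) (h, t). cyl p \<inter> A)"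
  proof (rule finite_measure_eq_AE)
    show "AE S in P. S \<in> {S. S (h + t) = (h, t)} \<inter> A \<longleftrightarrow> S \<in> (\<Union>p\<in>paths (0, 0) (h, t). cyl p \<inter> A)"
      using AE_standard
    proof eventually_elim
      case (elim S)
      have "\<exists>p\<in>paths (0, 0) (h, t). S \<in> cyl p" if "S (h + t) = (h, t)"
        using standard_path_in_paths[OF elim that]
        by (intro bexI[of _ "map S [0..<Suc (h + t)]"]) (auto simp: cyl_def simp del: upt_Suc)
      moreover have "S (h + t) = (h, t)" if "p \<in> paths (0, 0) (h, t)" "S \<in> cyl p" for p
        using that len[OF that(1)] by (auto simp: cyl_def paths_def last_conv_nth)
      ultimately show ?case by auto
    qed
    show "{S. S (h + t) = (h, t)} \<inter> A \<in> sets P"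
      using sets.Int[OF sets_vertex[of "h + t" "{(h, t)}"] A] by (simp add: sets_P)
    show "(\<Union>p\<in>paths (0, 0) (h, t). cyl p \<inter> A) \<in> sets P"
      unfolding sets_P by (intro sets.finite_UN finite_paths sets.Int sets_cyl A)
  qed
  also have "\<dots> = (\<Sum>p\<in>paths (0, 0) (h, t). prob (cyl p \<inter> A))"
  proof (rule finite_measure_finite_Union[OF finite_paths])
    show "(\<lambda>p. cyl p \<inter> A) ` paths (0, 0) (h, t) \<subseteq> events"
      using sets.Int[OF sets_cyl A] by (auto simp: sets_P)
    show "disjoint_family_on (\<lambda>p. cyl p \<inter> A) (paths (0, 0) (h, t))"
      unfolding disjoint_family_on_def
    proof (intro ballI impI)
      fix p q assume "p \<in> paths (0, 0) (h, t)" "q \<in> paths (0, 0) (h, t)" "p \<noteq> q"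
      then show "cyl p \<inter> A \<inter> (cyl q \<inter> A) = {}"
        using len by (auto simp: cyl_def) (metis nth_equalityI)
    qed
  qed
  finally show ?thesis .
qed

lemma prob_vertex:
  "prob {S. S (h + t) = (h, t)} = (\<Sum>p\<in>paths (0, 0) (h, t). prob (cyl p))"
  using prob_vertex_Int[of UNIV h t] sets.top[of path_space] by simp

text \<open>If a cylinder probability is the path weight times a function of the endpoint, both
  defining properties follow: conditioning on the endpoint cancels the function and leaves the
  weight, and the next step depends on the past only through the endpoint.\<close>

lemma laws_of_cyl:
  assumes cyl: "\<And>p. std p \<Longrightarrow> prob (cyl p) = path_weight w p * \<phi> (fst (last p)) (snd (last p))"
    and pos: "\<And>h t. path_sum w (0, 0) (h, t) > 0"
  shows "P \<in> laws w" "prob_fun w P h t = \<phi> h t"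
proof -
  have vertex: "prob {S. S (h + t) = (h, t)} = path_sum w (0, 0) (h, t) * \<phi> h t" for h t
  proof -
    have "prob (cyl p) = path_weight w p * \<phi> h t" if "p \<in> paths (0, 0) (h, t)" for p
    proof -
      have "last p = (h, t)" "std p" using that by (auto simp: paths_def std_def)
      then show ?thesis using cyl[of p] by simp
    qed
    then show ?thesis unfolding prob_vertex path_sum_def sum_distrib_right by (intro sum.cong) auto
  qed
  show "prob_fun w P h t = \<phi> h t"
    using pos[of h t] by (simp add: prob_fun_def vertex)
  have cond: "conditioning_property w P"
    unfolding conditioning_property_def cond_prob_def
  proof (intro allI impI ballI)
    fix h t p
    assume p0: "0 < prob {S \<in> space P. S (h + t) = (h, t)}" and p: "p \<in> paths (0, 0) (h, t)"
    have lp: "last p = (h, t)" "std p" using p by (auto simp: paths_def std_def)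
    have "{S \<in> space P. (\<forall>i<length p. S i = p ! i) \<and> S (h + t) = (h, t)} = cyl p"
      using length_std[OF lp(2)] lp by (auto simp: cyl_def std_def last_conv_nth)
    then show "prob {S \<in> space P. (\<forall>i<length p. S i = p ! i) \<and> S (h + t) = (h, t)} /
        prob {S \<in> space P. S (h + t) = (h, t)} = path_weight w p / path_sum w (0, 0) (h, t)"
      using p0 cyl[OF lp(2)] lp(1) by (auto simp: vertex)
  qed
  have markov: "markov_chain P"
    unfolding markov_chain_def cond_prob_def
  proof (intro allI impI)
    fix n s y
    assume p0: "0 < prob {S \<in> space P. \<forall>i\<le>n. S i = s i}"
    define p where "p = map s [0..<Suc n]"
    have p: "{S \<in> space P. \<forall>i\<le>n. S i = s i} = cyl p"
      by (auto simp: cyl_def p_def less_Suc_eq_le simp del: upt_Suc)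
    have len: "length p = Suc n" and ne: "p \<noteq> []" and last: "last p = s n"
      by (auto simp: p_def last_map)
    have std: "std p" using p0 prob_not_std[OF ne] unfolding p by force
    obtain h t where sn: "s n = (h, t)" by fastforce
    have n: "n = h + t" using length_std[OF std] last sn len by simp
    \<comment> \<open>The one-step factor common to all histories that end at \<open>(h, t)\<close>.
      Its value 0 off the edges matches the null cylinders of lists that are not standard
      paths.\<close>
    define q where "q = (if is_edge (h, t) y then w (h, t) y * \<phi> (fst y) (snd y) else 0)"
    have snoc: "prob (cyl (p' @ [y])) = path_weight w p' * q" if "std p'" "last p' = (h, t)" for p'
    proof (cases "is_edge (h, t) y")
      case True
      have "p' \<noteq> []" using that by (simp add: std_def)
      then show ?thesis using cyl[of "p' @ [y]"] std_snoc[OF that(1), of y] True that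
        by (simp add: q_def path_weight_snoc)
    next
      case False
      then show ?thesis using prob_not_std[of "p' @ [y]"] std_snoc[OF that(1), of y] that
        by (simp add: q_def)
    qed
    have 1: "{S \<in> space P. S (Suc n) = y \<and> (\<forall>i\<le>n. S i = s i)} = cyl (p @ [y])"
      using p by (auto simp: cyl_snoc len)
    have "prob {S \<in> space P. S (Suc n) = y \<and> S n = s n} =
        prob ({S. S (h + t) = (h, t)} \<inter> {S. S (Suc n) \<in> {y}})"
      by (intro arg_cong[where f = prob]) (auto simp: n sn[unfolded n])
    also have "\<dots> = (\<Sum>p'\<in>paths (0, 0) (h, t). prob (cyl p' \<inter> {S. S (Suc n) \<in> {y}}))"
      by (intro prob_vertex_Int sets_vertex)
    also have "\<dots> = (\<Sum>p'\<in>paths (0, 0) (h, t). path_weight w p' * q)"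
    proof (rule sum.cong)
      fix p' assume "p' \<in> paths (0, 0) (h, t)"
      then have p': "std p'" "last p' = (h, t)" by (auto simp: paths_def std_def)
      have "cyl p' \<inter> {S. S (Suc n) \<in> {y}} = cyl (p' @ [y])"
        using length_std[OF p'(1)] p'(2) by (auto simp: cyl_snoc n)
      then show "prob (cyl p' \<inter> {S. S (Suc n) \<in> {y}}) = path_weight w p' * q"
        using snoc[OF p'] by simp
    qed simp
    also have "\<dots> = path_sum w (0, 0) (h, t) * q"
      by (simp add: path_sum_def sum_distrib_right)
    finally have 2: "prob {S \<in> space P. S (Suc n) = y \<and> S n = s n} = path_sum w (0, 0) (h, t) * q" .
    have 3: "prob {S \<in> space P. S n = s n} = path_sum w (0, 0) (h, t) * \<phi> h t"
      using vertex[of h t] by (simp add: n sn[unfolded n])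
    have 4: "prob (cyl p) = path_weight w p * \<phi> h t"
      using cyl[OF std] by (simp add: last sn)
    then have "path_weight w p \<noteq> 0" using p0 p by auto
    then show "prob {S \<in> space P. S (Suc n) = y \<and> (\<forall>i\<le>n. S i = s i)} / prob {S \<in> space P. \<forall>i\<le>n. S i = s i} =
        prob {S \<in> space P. S (Suc n) = y \<and> S n = s n} / prob {S \<in> space P. S n = s n}"
      unfolding 1 2 3 p using snoc[OF std] pos[of h t] by (simp add: 4 last sn)
  qed
  show "P \<in> laws w"
    unfolding laws_def using cond markov sets_P AE_standard prob_space_axioms by blast
qed

end

lemma path_law_laws: "P \<in> laws w \<Longrightarrow> path_law P"
  by (auto simp: laws_def path_law_def path_law_axioms_def)

text \<open>The conditioning property multiplied out, a converse to \<open>laws_of_cyl\<close>. It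
  says nothing when the endpoint has probability 0, but then the cylinder is contained in a null
  event and \<open>prob_fun\<close> is 0 as well.\<close>

lemma cyl_of_law:
  assumes P: "P \<in> laws w" and std: "std p" and pos: "\<And>h t. path_sum w (0, 0) (h, t) > 0"
  shows "measure P (cyl p) = path_weight w p * prob_fun w P (fst (last p)) (snd (last p))"
proof -
  interpret path_law P using P by (rule path_law_laws)
  obtain h t where lp: "last p = (h, t)" by fastforce
  have len: "length p = Suc (h + t)" using length_std[OF std] lp by simp
  have eq: "{S \<in> space P. (\<forall>i<length p. S i = p ! i) \<and> S (h + t) = (h, t)} = cyl p"
    using len lp std by (auto simp: cyl_def std_def last_conv_nth)
  have sub: "cyl p \<subseteq> {S. S (h + t) = (h, t)}" using eq by auto
  show ?thesis
  proof (cases "prob {S. S (h + t) = (h, t)} = 0")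
    case True
    have "{S. S (h + t) = (h, t)} \<in> sets P"
      using sets_vertex[of "h + t" "{(h, t)}"] by (simp add: sets_P)
    then have "prob (cyl p) = 0"
      using True finite_measure_mono[OF sub] measure_nonneg[of P "cyl p"] by simp
    then show ?thesis using True by (simp add: prob_fun_def lp)
  next
    case False
    then have "prob {S \<in> space P. S (h + t) = (h, t)} > 0" by (simp add: zero_less_measure_iff)
    moreover have "p \<in> paths (0, 0) (h, t)" using std lp by (simp add: paths_def std_def)
    ultimately have "prob (cyl p) / prob {S. S (h + t) = (h, t)} = path_weight w p / path_sum w (0, 0) (h, t)"
      using P unfolding laws_def conditioning_property_def cond_prob_def mem_Collect_eq eq[symmetric] by force
    then show ?thesis using False pos[of h t] by (simp add: prob_fun_def lp field_simps)
  qed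
qed

section \<open>Harmonic functions\<close>

locale pos_weights =
  fixes b :: "nat \<Rightarrow> real"
  assumes b_pos: "b h > 0"
begin

definition bs :: "nat \<Rightarrow> nat \<Rightarrow> nat \<Rightarrow> real" where
  "bs h H k = hsum (map b [h..<Suc H]) k"

definition d :: "nat \<Rightarrow> nat \<Rightarrow> nat \<Rightarrow> nat \<Rightarrow> real" where
  "d h t H T = (if h \<le> H \<and> t \<le> T then bs h H (T - t) else 0)"

definition harmonic :: "(nat \<Rightarrow> nat \<Rightarrow> real) \<Rightarrow> bool" where
  "harmonic \<phi> \<longleftrightarrow> (\<forall>h t. 0 \<le> \<phi> h t) \<and> (\<forall>h t. \<phi> h t = \<phi> (Suc h) t + b h * \<phi> h (Suc t))"

text \<open>Minimality as in Martin boundary theory, with the normalization built in; this makes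
  \<open>\<psi> 0 0\<close> the only possible factor of proportionality.\<close>

definition minimal :: "(nat \<Rightarrow> nat \<Rightarrow> real) \<Rightarrow> bool" where
  "minimal \<phi> \<longleftrightarrow> harmonic \<phi> \<and> \<phi> 0 0 = 1 \<and>
     (\<forall>\<psi> C. harmonic \<psi> \<longrightarrow> (\<forall>h t. \<psi> h t \<le> C * \<phi> h t) \<longrightarrow> (\<forall>h t. \<psi> h t = \<psi> 0 0 * \<phi> h t))"

text \<open>The candidates for minimal functions: \<open>phi_theta\<close> for
  \<open>x = 1 / \<theta>\<close>, \<open>phi_inf\<close> for \<open>x = 0\<close>, and for
  \<open>x = 1 / b m\<close> with a record value \<open>b m\<close> the function of
  \<open>Q_left\<close>, the product being 0 as soon as \<open>h > m\<close>.\<close>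

definition kern :: "real \<Rightarrow> nat \<Rightarrow> nat \<Rightarrow> real" where
  "kern x h t = x ^ t * (\<Prod>j<h. 1 - b j * x)"

lemma b_nonneg: "b h \<ge> 0"
  using b_pos[of h] by simp

lemma bs_pos: "h \<le> H \<Longrightarrow> bs h H k > 0"
  unfolding bs_def by (intro hsum_pos) (auto simp: b_pos)

lemma bs_nonneg: "bs h H k \<ge> 0"
  unfolding bs_def by (intro hsum_nonneg) (auto simp: b_nonneg)

lemma bs_Suc: "h \<le> H \<Longrightarrow> bs h H (Suc k) = bs (Suc h) H (Suc k) + b h * bs h H k"
proof -
  assume "h \<le> H"
  then have "map b [h..<Suc H] = b h # map b [Suc h..<Suc H]"
    by (subst upt_conv_Cons) auto
  then show ?thesis by (simp add: bs_def del: upt_Suc)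
qed

lemma bs_0 [simp]: "bs h H 0 = 1"
  by (simp add: bs_def)

lemma bs_Nil: "H < h \<Longrightarrow> bs h H k = (if k = 0 then 1 else 0)"
  by (simp add: bs_def hsum_Nil)

lemma bs_Suc_le: "bs h H k \<le> bs h (Suc H) k"
proof (cases "h \<le> Suc H")
  case True
  have "hsum (map b [h..<Suc H]) k \<le> hsum (map b [h..<Suc H] @ [b (Suc H)]) k"
    by (rule hsum_append_mono) (use b_nonneg in auto)
  then show ?thesis using True by (simp add: bs_def)
qed (simp add: bs_Nil)

lemma d_nonneg: "d h t H T \<ge> 0"
  by (simp add: d_def bs_nonneg)

lemma d_pos: "h \<le> H \<Longrightarrow> t \<le> T \<Longrightarrow> d h t H T > 0"
  by (simp add: d_def bs_pos)

lemma d_rec: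
  "d h t H T = (if h = H \<and> t = T then 1 else d (Suc h) t H T + b h * d h (Suc t) H T)"
proof (cases "h \<le> H \<and> t \<le> T")
  case True
  show ?thesis
  proof (cases "t = T")
    case True
    then show ?thesis using \<open>h \<le> H \<and> t \<le> T\<close> by (auto simp: d_def)
  next
    case False
    then have t: "T - t = Suc (T - Suc t)" using True by auto
    show ?thesis
    proof (cases "h = H")
      case True
      then show ?thesis using False \<open>h \<le> H \<and> t \<le> T\<close> t bs_Suc[of H H "T - Suc t"]
        by (simp add: d_def bs_Nil)
    next
      case hH: False
      then show ?thesis using True False bs_Suc[of h H "T - Suc t"]
        by (simp add: d_def t)
    qed
  qed
qed (auto simp: d_def)

lemma harmonicD:
  assumes "harmonic \<phi>"
  shows harmonic_nonneg: "\<phi> h t \<ge> 0" and harmonic_eq: "\<phi> h t = \<phi> (Suc h) t + b h * \<phi> h (Suc t)"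
  using assms unfolding harmonic_def by blast+

lemma harmonic_Suc_le:
  assumes "harmonic \<phi>"
  shows "\<phi> (Suc h) t \<le> \<phi> h t" "b h * \<phi> h (Suc t) \<le> \<phi> h t"
  using harmonic_eq[OF assms, of h t] harmonic_nonneg[OF assms] mult_nonneg_nonneg[OF b_nonneg[of h]]
  by simp_all

text \<open>Iterating the harmonic equation up to the antidiagonal of index \<open>n\<close>
  collects the weights of all paths leading there, and \<open>d\<close> sums them.\<close>

lemma harmonic_expand:
  assumes "harmonic \<phi>" and "h + t \<le> n"
  shows "\<phi> h t = (\<Sum>H\<le>n. d h t H (n - H) * \<phi> H (n - H))"
  using assms(2)
proof (induction "n - (h + t)" arbitrary: h t)
  case 0
  then have n: "n = h + t" by simp
  have "(\<Sum>H\<le>n. d h t H (n - H) * \<phi> H (n - H)) = (\<Sum>H\<le>n. if H = h then \<phi> h t else 0)"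
    by (intro sum.cong) (auto simp: d_def n)
  also have "\<dots> = \<phi> h t"
    using n by simp
  finally show ?case by simp
next
  case (Suc k)
  have *: "d h t H (n - H) = d (Suc h) t H (n - H) + b h * d h (Suc t) H (n - H)" if "H \<le> n" for H
    using Suc(2) that by (subst d_rec) auto
  have "(\<Sum>H\<le>n. d h t H (n - H) * \<phi> H (n - H)) =
      (\<Sum>H\<le>n. d (Suc h) t H (n - H) * \<phi> H (n - H)) + b h * (\<Sum>H\<le>n. d h (Suc t) H (n - H) * \<phi> H (n - H))"
    unfolding sum_distrib_left sum.distrib[symmetric]
    by (intro sum.cong) (simp_all add: * distrib_right mult.assoc)
  also have "\<dots> = \<phi> (Suc h) t + b h * \<phi> h (Suc t)"
    using Suc.hyps(1)[of "Suc h" t] Suc.hyps(1)[of h "Suc t"] Suc.hyps(2) by simp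
  finally show ?case using harmonic_eq[OF assms(1), of h t] by simp
qed

lemma harmonic_ge_sum:
  assumes "harmonic \<phi>" and "finite A" and "\<And>H T. (H, T) \<in> A \<Longrightarrow> H + T = n" and "h + t \<le> n"
  shows "(\<Sum>(H, T)\<in>A. d h t H T * \<phi> H T) \<le> \<phi> h t"
proof -
  have *: "A \<subseteq> (\<lambda>H. (H, n - H)) ` {..n}"
    using assms(3) by force
  have "(\<Sum>(H, T)\<in>A. d h t H T * \<phi> H T) \<le> (\<Sum>(H, T)\<in>(\<lambda>H. (H, n - H)) ` {..n}. d h t H T * \<phi> H T)"
    using * harmonic_nonneg[OF assms(1)] d_nonneg by (intro sum_mono2) auto
  also have "\<dots> = (\<Sum>H\<le>n. d h t H (n - H) * \<phi> H (n - H))"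
    by (subst sum.reindex) (auto simp: inj_on_def)
  also have "\<dots> = \<phi> h t"
    using harmonic_expand[OF assms(1,4)] by simp
  finally show ?thesis .
qed

lemma harmonic_ge:
  assumes "harmonic \<phi>"
  shows "d h t H T * \<phi> H T \<le> \<phi> h t"
proof (cases "h + t \<le> H + T")
  case True
  then show ?thesis using harmonic_ge_sum[OF assms, of "{(H, T)}" "H + T" h t] by simp
next
  case False
  then have "d h t H T = 0" by (auto simp: d_def)
  then show ?thesis using harmonic_nonneg[OF assms] by simp
qed

lemma harmonic_zero:
  assumes "harmonic \<phi>" "\<phi> 0 0 = 0"
  shows "\<phi> h t = 0"
proof -
  have "d 0 0 h t * \<phi> h t \<le> 0" using harmonic_ge[OF assms(1), of 0 0 h t] assms(2) by simp
  then show ?thesis using d_pos[of 0 h 0 t] harmonic_nonneg[OF assms(1), of h t]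
    by (simp add: mult_le_0_iff)
qed

lemma harmonic_determined:
  assumes "\<And>h t. \<phi> h t = \<phi> (Suc h) t + b h * \<phi> h (Suc t)"
    and "\<And>h t. \<psi> h t = \<psi> (Suc h) t + b h * \<psi> h (Suc t)"
    and "\<And>t. \<phi> 0 t = \<psi> 0 t"
  shows "\<phi> h t = \<psi> h t"
proof (induction h arbitrary: t)
  case (Suc h)
  then show ?case using assms(1,2)[of h t] Suc[of t] Suc[of "Suc t"] by simp
qed (fact assms(3))

lemma kern_rec: "kern x h t = kern x (Suc h) t + b h * kern x h (Suc t)"
  by (simp add: kern_def algebra_simps)

lemma kern_0 [simp]: "kern x 0 t = x ^ t"
  by (simp add: kern_def)

lemma harmonic_kern: "x \<ge> 0 \<Longrightarrow> (\<And>h. (\<Prod>j<h. 1 - b j * x) \<ge> 0) \<Longrightarrow> harmonic (kern x)"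
  unfolding harmonic_def
  by (intro conjI allI kern_rec) (simp add: kern_def)

lemma harmonic_lincomb:
  assumes "harmonic \<phi>" and "harmonic \<psi>" and "\<And>h t. 0 \<le> u * \<phi> h t + v * \<psi> h t"
  shows "harmonic (\<lambda>h t. u * \<phi> h t + v * \<psi> h t)"
  unfolding harmonic_def
proof (intro conjI allI)
  fix h t
  show "u * \<phi> h t + v * \<psi> h t = u * \<phi> (Suc h) t + v * \<psi> (Suc h) t +
      b h * (u * \<phi> h (Suc t) + v * \<psi> h (Suc t))"
    unfolding harmonic_eq[OF assms(1), of h t] harmonic_eq[OF assms(2), of h t] by (simp add: algebra_simps)
qed (fact assms(3))

section \<open>The Martin kernel\<close>

definition rho :: "nat \<Rightarrow> nat \<Rightarrow> real" where
  "rho H k = bs 0 H (Suc k) / bs 0 H k"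

lemma rho_pos: "rho H k > 0"
  unfolding rho_def using bs_pos[of 0 H] by (intro divide_pos_pos) auto

text \<open>Log-concavity, read as monotonicity of the ratios of consecutive terms.\<close>

lemma rho_antimono: "k \<le> l \<Longrightarrow> rho H l \<le> rho H k"
proof (rule lift_Suc_antimono_le[of "rho H"])
  fix k
  have "bs 0 H k * bs 0 H (Suc (Suc k)) \<le> bs 0 H (Suc k) ^ 2"
    unfolding bs_def using b_pos by (intro hsum_log_concave) auto
  then show "rho H (Suc k) \<le> rho H k"
    using bs_pos[of 0 H k] bs_pos[of 0 H "Suc k"]
    by (simp add: rho_def divide_simps power2_eq_square mult.commute)
qed

text \<open>The ratios of consecutive terms of \<open>k! h_k\<close> are
  \<open>Suc k * rho H k\<close>, so this is log-convexity of that sequence.\<close>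

lemma Suc_rho_mono: "k \<le> l \<Longrightarrow> real (Suc k) * rho H k \<le> real (Suc l) * rho H l"
proof (rule lift_Suc_mono_le[of "\<lambda>k. real (Suc k) * rho H k"])
  fix k
  have "real (Suc k) * bs 0 H (Suc k) ^ 2 \<le> real (Suc (Suc k)) * bs 0 H k * bs 0 H (Suc (Suc k))"
    unfolding bs_def using b_pos by (intro hsum_log_convex) auto
  then show "real (Suc k) * rho H k \<le> real (Suc (Suc k)) * rho H (Suc k)"
    using bs_pos[of 0 H k] bs_pos[of 0 H "Suc k"]
    by (simp add: rho_def divide_simps power2_eq_square mult_ac del: of_nat_Suc)
qed

lemma bs_ge_mult:
  assumes "h \<le> j" "j \<le> H" shows "b j * bs h H k \<le> bs h H (Suc k)"
proof -
  have "[h..<Suc H] = [h..<j] @ j # [Suc j..<Suc H]"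
    using assms upt_add_eq_append[of h j "Suc H - j"] upt_conv_Cons[of j "Suc H"] by simp
  then have "map b [h..<Suc H] = map b [h..<j] @ b j # map b [Suc j..<Suc H]"
    by (metis list.simps(9) map_append)
  then show ?thesis
    using hsum_remove[of "map b [h..<j]" "b j" "map b [Suc j..<Suc H]" k]
      hsum_nonneg[of "map b [h..<j] @ map b [Suc j..<Suc H]" "Suc k"] b_nonneg
    by (auto simp: bs_def simp del: upt_Suc)
qed

lemma rho_ge: "j \<le> H \<Longrightarrow> b j \<le> rho H k"
  using bs_ge_mult[of 0 j H k] bs_pos[of 0 H k] by (simp add: rho_def le_divide_eq)

text \<open>The increasing sequence of \<open>Suc_rho_mono\<close> starts at \<open>k = 0\<close>
  with the sum of the variables.\<close>

lemma sum_le_rho: "(\<Sum>j\<le>H. b j) \<le> real (Suc k) * rho H k"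
proof -
  have "(\<Sum>j\<le>H. b j) = rho H 0"
    unfolding rho_def bs_def hsum_Suc_0
    by (simp add: sum_list_distinct_conv_sum_set atLeast0LessThan lessThan_Suc_atMost del: upt_Suc)
  then show ?thesis using Suc_rho_mono[of 0 k H] by simp
qed

section \<open>The Martin kernel and its defect as an eigenfunction of the shift in t\<close>

definition xr :: "nat \<Rightarrow> nat \<Rightarrow> real" where
  "xr H T = d 0 1 H T / d 0 0 H T"

definition martin :: "nat \<Rightarrow> nat \<Rightarrow> nat \<Rightarrow> nat \<Rightarrow> real" where
  "martin h t H T = d h t H T / d 0 0 H T"

text \<open>An exact kernel satisfies \<open>kern x h (Suc t) = x * kern x h t\<close>. This is the
  amount by which the Martin kernel with pole \<open>(H, T)\<close> misses that equation for
  \<open>x = xr H T\<close>.\<close>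

definition martin_err :: "nat \<Rightarrow> nat \<Rightarrow> nat \<Rightarrow> nat \<Rightarrow> real" where
  "martin_err h t H T = martin h (Suc t) H T - xr H T * martin h t H T"

lemma xr_0: "xr H 0 = 0"
  by (simp add: xr_def d_def)

lemma xr_Suc: "xr H (Suc T) = 1 / rho H T"
  by (simp add: xr_def d_def rho_def)

lemma xr_nonneg: "xr H T \<ge> 0"
  by (simp add: xr_def d_nonneg)

lemma xr_le: "j \<le> H \<Longrightarrow> b j * xr H T \<le> 1"
  using rho_ge[of j H "T - 1"] rho_pos[of H "T - 1"]
  by (cases T) (simp_all add: xr_0 xr_Suc divide_simps)

lemma xr_le_inverse: "xr H T \<le> 1 / b 0"
  using xr_le[of 0 H T] b_pos[of 0] by (simp add: field_simps)

text \<open>Controls the error bound at positions with many heads when the sum of \<open>b\<close>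
  diverges; positions with many tails are covered by \<open>xr_le_inverse\<close>. For
  \<open>T = 0\<close> the left side is 0.\<close>

lemma xr_div_le: "xr H T / T \<le> 1 / (\<Sum>j\<le>H. b j)"
proof (cases T)
  case (Suc k)
  have "(\<Sum>j\<le>H. b j) > 0" using b_pos by (intro sum_pos) auto
  then have "1 / (real (Suc k) * rho H k) \<le> 1 / (\<Sum>j\<le>H. b j)"
    using sum_le_rho[of H k] by (intro divide_left_mono) auto
  then show ?thesis by (simp add: Suc xr_Suc mult.commute)
qed (simp add: xr_0 sum_nonneg b_nonneg)

lemma martin_nonneg: "martin h t H T \<ge> 0"
  by (simp add: martin_def d_nonneg)

lemma martin_0_0: "martin 0 0 H T = 1"
  using d_pos[of 0 H 0 T] by (simp add: martin_def)

lemma martin_0_1: "martin 0 1 H T = xr H T"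
  by (simp add: martin_def xr_def)

lemma martin_rec: "(h, t) \<noteq> (H, T) \<Longrightarrow> martin h t H T = martin (Suc h) t H T + b h * martin h (Suc t) H T"
  unfolding martin_def by (subst d_rec) (auto simp: add_divide_distrib)

lemma martin_0_le: "martin 0 t H T \<le> (1 / b 0) ^ t"
proof (induction t)
  case (Suc t)
  have "b 0 * martin 0 (Suc t) H T \<le> martin 0 t H T"
  \<comment> \<open>The Martin kernel violates the harmonic equation only at its own pole.\<close>
  proof (cases "(0, t) = (H, T)")
    case True
    then have "martin 0 (Suc t) H T = 0" by (simp add: martin_def d_def)
    then show ?thesis by (simp add: martin_nonneg)
  next
    case False
    then show ?thesis using martin_rec[of 0 t H T] martin_nonneg by simp
  qed
  also note Suc
  finally show ?case using b_pos[of 0] by (simp add: field_simps)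
qed (simp add: martin_0_0)

text \<open>For \<open>t < T\<close> the defect is the kernel times the difference of the reciprocal
  ratios \<open>R\<close> and \<open>x\<close>, taken \<open>t\<close> indices apart. Log-concavity
  gives \<open>R \<le> x\<close>, and log-convexity of \<open>k! h_k\<close> gives
  \<open>x - R \<le> t * x / T\<close>.\<close>

lemma martin_err_0_bound: "\<bar>martin_err 0 t H T\<bar> \<le> real t * (1 / b 0) ^ t * (xr H T / T)"
proof -
  consider "t = 0" | "T = 0" | "t \<ge> T" "t > 0" "T > 0" | "t < T" "t > 0"
    by linarith
  then show ?thesis
  proof cases
    case 1
    then show ?thesis by (simp add: martin_err_def martin_0_0 martin_0_1[simplified])
  next
    case 2
    then show ?thesis by (simp add: martin_err_def xr_0 martin_def d_def)
  next
    case 3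
    then have "martin 0 (Suc t) H T = 0" by (simp add: martin_def d_def)
    then have "\<bar>martin_err 0 t H T\<bar> = xr H T * martin 0 t H T"
      by (simp add: martin_err_def xr_nonneg martin_nonneg)
    also have "\<dots> \<le> xr H T * (1 / b 0) ^ t"
      using martin_0_le xr_nonneg by (intro mult_left_mono)
    \<comment> \<open>In this case \<open>t \<ge> T\<close>, so the inserted factor is at least
      1.\<close>
    also have "\<dots> \<le> (real t / real T) * (xr H T * (1 / b 0) ^ t)"
      using 3 xr_nonneg[of H T] b_pos[of 0]
        mult_right_mono[of 1 "real t / real T" "xr H T * (1 / b 0) ^ t"] by simp
    finally show ?thesis by (simp add: mult_ac)
  next
    case 4
    define k where "k = T - Suc t"
    have T: "T = Suc (k + t)" using 4 by (simp add: k_def)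
    define x where "x = xr H T"
    define R where "R = 1 / rho H k"
    have x: "x = 1 / rho H (k + t)" by (simp add: x_def T xr_Suc)
    have "martin 0 (Suc t) H T = R * martin 0 t H T"
      using bs_pos[of 0 H "Suc k"] by (simp add: martin_def d_def T R_def rho_def Suc_diff_le)
    then have martin_err: "martin_err 0 t H T = martin 0 t H T * (R - x)"
      by (simp add: martin_err_def x_def algebra_simps)
    have Rx: "R \<le> x" unfolding R_def x
      using rho_antimono[of k "k + t" H] rho_pos[of H] by (intro divide_left_mono) auto
    have "real (Suc k) * rho H k \<le> real T * rho H (k + t)"
      using Suc_rho_mono[of k "k + t" H] unfolding T by simp
    then have "real (Suc k) * x \<le> real T * R"
      unfolding x R_def using rho_pos[of H k] rho_pos[of H "k + t"]
      by (simp add: divide_simps mult_ac del: of_nat_Suc)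
    then have "real T * (x - R) \<le> real t * x"
      unfolding T by (simp add: algebra_simps)
    then have xR: "x - R \<le> real t * (x / real T)"
      using 4 by (simp add: field_simps)
    have "\<bar>martin_err 0 t H T\<bar> = martin 0 t H T * (x - R)"
      using Rx by (simp add: martin_err abs_mult martin_nonneg)
    also have "\<dots> \<le> (1 / b 0) ^ t * (real t * (x / real T))"
      using xR Rx martin_0_le martin_nonneg b_pos[of 0] by (intro mult_mono) auto
    finally show ?thesis by (simp add: x_def mult_ac)
  qed
qed

text \<open>The defect is linear in the kernel and inherits the harmonic equation away from the
  pole. In this way estimates for column 0 propagate to every column.\<close>

lemma martin_err_rec:
  assumes "Suc (h + t) < H + T"
  shows "martin_err (Suc h) t H T = martin_err h t H T - b h * martin_err h (Suc t) H T"
proof -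
  have "martin h t H T = martin (Suc h) t H T + b h * martin h (Suc t) H T"
    "martin h (Suc t) H T = martin (Suc h) (Suc t) H T + b h * martin h (Suc (Suc t)) H T"
    using assms by (auto intro!: martin_rec)
  then show ?thesis unfolding martin_err_def by (simp add: algebra_simps)
qed

section \<open>Averages over the position at time n\<close>

definition avg :: "(nat \<Rightarrow> nat \<Rightarrow> real) \<Rightarrow> (nat \<Rightarrow> nat \<Rightarrow> real) \<Rightarrow> nat \<Rightarrow> real" where
  "avg \<phi> f n = (\<Sum>H\<le>n. d 0 0 H (n - H) * \<phi> H (n - H) * f H (n - H))"

text \<open>Convergence is demanded in column 0 only; \<open>regular_martin_err\<close> extends it
  to all columns.\<close>

definition regular :: "(nat \<Rightarrow> nat \<Rightarrow> real) \<Rightarrow> bool" where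
  "regular \<phi> \<longleftrightarrow> harmonic \<phi> \<and> (\<forall>t. avg \<phi> (\<lambda>H T. \<bar>martin_err 0 t H T\<bar>) \<longlonglongrightarrow> 0)"

lemma avg_mono:
  assumes "harmonic \<phi>" "\<And>H T. H + T = n \<Longrightarrow> f H T \<le> g H T"
  shows "avg \<phi> f n \<le> avg \<phi> g n"
  unfolding avg_def using assms d_nonneg harmonic_nonneg[OF assms(1)]
  by (intro sum_mono mult_left_mono mult_nonneg_nonneg) auto

lemma avg_nonneg:
  assumes "harmonic \<phi>" "\<And>H T. f H T \<ge> 0"
  shows "avg \<phi> f n \<ge> 0"
  using avg_mono[OF assms(1), of n "\<lambda>_ _. 0" f] assms(2) by (simp add: avg_def)

lemma avg_add: "avg \<phi> (\<lambda>H T. f H T + g H T) n = avg \<phi> f n + avg \<phi> g n"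
  by (simp add: avg_def distrib_left sum.distrib)

lemma avg_cmult: "avg \<phi> (\<lambda>H T. c * f H T) n = c * avg \<phi> f n"
  by (simp add: avg_def sum_distrib_left mult_ac)

text \<open>For normalized \<open>\<phi>\<close>, the law with probability function
  \<open>\<phi>\<close> visits \<open>(H, T)\<close> with probability
  \<open>d 0 0 H T * \<phi> H T\<close>, so \<open>avg\<close> is an expectation at time
  \<open>n\<close>. The denominator of the Martin kernel cancels the first factor, and
  \<open>harmonic_expand\<close> remains.\<close>

lemma avg_martin:
  assumes "harmonic \<phi>" "h + t \<le> n"
  shows "avg \<phi> (martin h t) n = \<phi> h t"
proof -
  have "avg \<phi> (martin h t) n = (\<Sum>H\<le>n. d h t H (n - H) * \<phi> H (n - H))"
    unfolding avg_def using d_pos[of 0 _ 0] by (intro sum.cong) (simp_all add: martin_def less_imp_neq[symmetric])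
  then show ?thesis using harmonic_expand[OF assms] by simp
qed

lemma avg_1: "harmonic \<phi> \<Longrightarrow> avg \<phi> (\<lambda>_ _. c) n = c * \<phi> 0 0"
  using avg_martin[of \<phi> 0 0 n] avg_cmult[of \<phi> c "\<lambda>_ _. 1" n] by (simp add: martin_0_0 avg_def)

lemma regular_martin_err:
  assumes "regular \<phi>"
  shows "avg \<phi> (\<lambda>H T. \<bar>martin_err h t H T\<bar>) \<longlonglongrightarrow> 0"
proof (induction h arbitrary: t)
  case 0
  then show ?case using assms by (simp add: regular_def)
next
  case (Suc h)
  have har: "harmonic \<phi>" using assms by (simp add: regular_def)
  have "(\<lambda>n. avg \<phi> (\<lambda>H T. \<bar>martin_err h t H T\<bar>) n + b h * avg \<phi> (\<lambda>H T. \<bar>martin_err h (Suc t) H T\<bar>) n) \<longlonglongrightarrow> 0 + b h * 0"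
    by (intro tendsto_intros Suc)
  moreover have "\<forall>\<^sub>F n in sequentially. norm (avg \<phi> (\<lambda>H T. \<bar>martin_err (Suc h) t H T\<bar>) n) \<le>
      avg \<phi> (\<lambda>H T. \<bar>martin_err h t H T\<bar>) n + b h * avg \<phi> (\<lambda>H T. \<bar>martin_err h (Suc t) H T\<bar>) n"
    using eventually_gt_at_top[of "Suc (h + t)"]
  proof eventually_elim
    case (elim n)
    have "avg \<phi> (\<lambda>H T. \<bar>martin_err (Suc h) t H T\<bar>) n \<le> avg \<phi> (\<lambda>H T. \<bar>martin_err h t H T\<bar> + b h * \<bar>martin_err h (Suc t) H T\<bar>) n"
    proof (rule avg_mono[OF har])
      fix H T assume "H + T = n"
      then have "martin_err (Suc h) t H T = martin_err h t H T - b h * martin_err h (Suc t) H T"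
        using elim by (intro martin_err_rec) simp
      then show "\<bar>martin_err (Suc h) t H T\<bar> \<le> \<bar>martin_err h t H T\<bar> + b h * \<bar>martin_err h (Suc t) H T\<bar>"
        using b_nonneg[of h] by (metis abs_mult abs_of_nonneg abs_triangle_ineq4)
    qed
    then show ?case by (simp add: avg_add avg_cmult avg_nonneg[OF har])
  qed
  ultimately show ?case by (auto intro: Lim_null_comparison)
qed

text \<open>For exact eigenfunctions this would be \<open>b 0 * xr H T \<le> 1\<close>. The Martin
  kernels satisfy it up to \<open>b 0\<close> times their defect, and the average of the defect
  tends to 0.\<close>

lemma regular_shift_le:
  assumes "regular \<phi>"
  shows "b 0 * \<phi> h (Suc t) \<le> \<phi> h t"
proof -
  have har: "harmonic \<phi>" using assms by (simp add: regular_def)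
  have "(\<lambda>n. - b 0 * avg \<phi> (\<lambda>H T. \<bar>martin_err h t H T\<bar>) n) \<longlonglongrightarrow> - b 0 * 0"
    by (intro tendsto_intros regular_martin_err assms)
  moreover have "\<forall>\<^sub>F n in sequentially.
      - b 0 * avg \<phi> (\<lambda>H T. \<bar>martin_err h t H T\<bar>) n \<le> \<phi> h t - b 0 * \<phi> h (Suc t)"
    using eventually_gt_at_top[of "Suc (h + t)"]
  proof eventually_elim
    case (elim n)
    have "avg \<phi> (\<lambda>H T. - b 0 * \<bar>martin_err h t H T\<bar>) n \<le> avg \<phi> (\<lambda>H T. martin h t H T + (- b 0) * martin h (Suc t) H T) n"
    proof (rule avg_mono[OF har])
      fix H T
      have "martin h t H T - b 0 * martin h (Suc t) H T = martin h t H T * (1 - b 0 * xr H T) - b 0 * martin_err h t H T"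
        by (simp add: martin_err_def algebra_simps)
      moreover have "0 \<le> martin h t H T * (1 - b 0 * xr H T)"
        using xr_le[of 0 H T] martin_nonneg by (intro mult_nonneg_nonneg) auto
      moreover have "b 0 * martin_err h t H T \<le> b 0 * \<bar>martin_err h t H T\<bar>"
        using b_nonneg by (intro mult_left_mono) auto
      ultimately show "- b 0 * \<bar>martin_err h t H T\<bar> \<le> martin h t H T + (- b 0) * martin h (Suc t) H T" by simp
    qed
    then show ?case
      using elim unfolding avg_add avg_cmult by (simp add: avg_martin[OF har])
  qed
  ultimately have "- b 0 * 0 \<le> \<phi> h t - b 0 * \<phi> h (Suc t)"
    by (intro tendsto_upperbound) auto
  then show ?thesis by simp
qed

text \<open>The functional \<open>x\<^sup>t \<mapsto> \<phi> 0 t\<close> is nonnegative on \<open>x\<^sup>t (x - y)\<^sup>2\<close>.\<close>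

lemma regular_square:
  assumes "regular \<phi>"
  shows "0 \<le> \<phi> 0 (Suc (Suc t)) - 2 * y * \<phi> 0 (Suc t) + y\<^sup>2 * \<phi> 0 t"
proof -
  have har: "harmonic \<phi>" using assms by (simp add: regular_def)
  \<comment> \<open>A bound for the absolute value of \<open>xr H T - 2 * y\<close>, the coefficient
    of the second defect below.\<close>
  define c where "c = 1 / b 0 + 2 * \<bar>y\<bar>"
  let ?e = "\<lambda>t H T. \<bar>martin_err 0 t H T\<bar>"
  have "(\<lambda>n. - (avg \<phi> (?e (Suc t)) n + c * avg \<phi> (?e t) n)) \<longlonglongrightarrow> - (0 + c * 0)"
    by (intro tendsto_intros regular_martin_err assms)
  moreover have "\<forall>\<^sub>F n in sequentially. - (avg \<phi> (?e (Suc t)) n + c * avg \<phi> (?e t) n) \<le>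
      \<phi> 0 (Suc (Suc t)) - 2 * y * \<phi> 0 (Suc t) + y\<^sup>2 * \<phi> 0 t"
    using eventually_gt_at_top[of "Suc (Suc t)"]
  proof eventually_elim
    case (elim n)
    have "avg \<phi> (\<lambda>H T. (-1) * ?e (Suc t) H T + (- c) * ?e t H T) n \<le>
      avg \<phi> (\<lambda>H T. (martin 0 (Suc (Suc t)) H T + (- 2 * y) * martin 0 (Suc t) H T) + y\<^sup>2 * martin 0 t H T) n"
    proof (rule avg_mono[OF har])
      fix H T
      let ?x = "xr H T"
      \<comment> \<open>Replacing shifts by multiplication with \<open>xr H T\<close> produces the
        square, at the price of two defects.\<close>
      have "martin 0 (Suc (Suc t)) H T - 2 * y * martin 0 (Suc t) H T + y\<^sup>2 * martin 0 t H T =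
          (?x - y)\<^sup>2 * martin 0 t H T + martin_err 0 (Suc t) H T + (?x - 2 * y) * martin_err 0 t H T"
        by (simp add: martin_err_def power2_eq_square algebra_simps)
      moreover have "\<bar>(?x - 2 * y) * martin_err 0 t H T\<bar> \<le> c * \<bar>martin_err 0 t H T\<bar>"
        unfolding abs_mult c_def using xr_nonneg[of H T] xr_le_inverse[of H T]
        by (intro mult_right_mono) auto
      moreover have "0 \<le> (?x - y)\<^sup>2 * martin 0 t H T" using martin_nonneg by simp
      ultimately show "(-1) * ?e (Suc t) H T + (- c) * ?e t H T \<le>
          (martin 0 (Suc (Suc t)) H T + (- 2 * y) * martin 0 (Suc t) H T) + y\<^sup>2 * martin 0 t H T"
        using abs_ge_minus_self[of "(?x - 2 * y) * martin_err 0 t H T"] abs_ge_minus_self[of "martin_err 0 (Suc t) H T"]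
        by linarith
    qed
    then show ?case
      using elim unfolding avg_add avg_cmult by (simp add: avg_martin[OF har])
  qed
  ultimately have "- (0 + c * 0) \<le> \<phi> 0 (Suc (Suc t)) - 2 * y * \<phi> 0 (Suc t) + y\<^sup>2 * \<phi> 0 t"
    by (intro tendsto_upperbound) auto
  then show ?thesis by simp
qed

section \<open>Criteria for regularity\<close>

lemma regularI_not_summable:
  assumes "harmonic \<phi>" "\<not> summable b"
  shows "regular \<phi>"
  unfolding regular_def
proof (intro conjI allI)
  fix t
  define C where "C = real t * (1 / b 0) ^ t"
  have C: "C \<ge> 0" using b_nonneg by (simp add: C_def)
  \<comment> \<open>A late position has many heads or many tails. In the first case the partial sum
    of \<open>b\<close> is large, in the second \<open>xr H T\<close> is bounded and the divisor
    \<open>T\<close> is large.\<close>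
  have small: "\<exists>N. \<forall>H T. N \<le> H + T \<longrightarrow> xr H T / T \<le> \<epsilon>" if "\<epsilon> > 0" for \<epsilon> :: real
  proof -
    have "\<exists>n. 1 / \<epsilon> < (\<Sum>j\<le>n. b j)"
      using assms(2) b_nonneg by (meson bounded_imp_summable not_less)
    then obtain N1 where "1 / \<epsilon> < (\<Sum>j\<le>N1. b j)" by blast
    moreover have "(\<Sum>j\<le>N1. b j) \<le> (\<Sum>j\<le>n. b j)" if "n \<ge> N1" for n
      using that b_nonneg by (intro sum_mono2) auto
    ultimately have N1: "\<And>n. n \<ge> N1 \<Longrightarrow> 1 / \<epsilon> \<le> (\<Sum>j\<le>n. b j)"
      by (meson less_imp_le order_trans)
    obtain N2 :: nat where N2: "1 / (b 0 * \<epsilon>) < real N2"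
      using reals_Archimedean2 by blast
    have "xr H T / T \<le> \<epsilon>" if "N1 + N2 \<le> H + T" for H T
    proof (cases "N1 \<le> H")
      case True
      then have S: "1 / \<epsilon> \<le> (\<Sum>j\<le>H. b j)" by (rule N1)
      have "1 / (\<Sum>j\<le>H. b j) \<le> 1 / (1 / \<epsilon>)"
        using S \<open>\<epsilon> > 0\<close> less_le_trans[of 0 "1 / \<epsilon>", OF _ S] by (intro divide_left_mono mult_pos_pos) auto
      then show ?thesis using xr_div_le[of H T] by simp
    next
      case False
      then have T: "N2 \<le> T" using that by simp
      then have T': "1 / (b 0 * \<epsilon>) < real T" using N2 by linarith
      moreover have "0 < 1 / (b 0 * \<epsilon>)" using b_pos \<open>\<epsilon> > 0\<close> by simp
      ultimately have "0 < real T" by linarith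
      have "xr H T / T \<le> (1 / b 0) / T"
        using xr_le_inverse by (intro divide_right_mono) auto
      also have "\<dots> \<le> \<epsilon>"
        using T' \<open>0 < real T\<close> b_pos[of 0] \<open>\<epsilon> > 0\<close> by (simp add: field_simps)
      finally show ?thesis .
    qed
    then show ?thesis by blast
  qed
  show "avg \<phi> (\<lambda>H T. \<bar>martin_err 0 t H T\<bar>) \<longlonglongrightarrow> 0"
  proof (rule LIMSEQ_I)
    fix r :: real assume "r > 0"
    define \<epsilon> where "\<epsilon> = r / (2 * (C + 1) * (\<phi> 0 0 + 1))"
    have \<phi>0: "\<phi> 0 0 \<ge> 0" using harmonic_nonneg[OF assms(1)] .
    have \<epsilon>: "\<epsilon> > 0" using \<open>r > 0\<close> C \<phi>0 by (simp add: \<epsilon>_def)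
    obtain N where N: "\<And>H T. N \<le> H + T \<Longrightarrow> xr H T / T \<le> \<epsilon>" using small[OF \<epsilon>] by blast
    have "norm (avg \<phi> (\<lambda>H T. \<bar>martin_err 0 t H T\<bar>) n - 0) < r" if "n \<ge> N" for n
    proof -
      have "avg \<phi> (\<lambda>H T. \<bar>martin_err 0 t H T\<bar>) n \<le> avg \<phi> (\<lambda>_ _. C * \<epsilon>) n"
        using that C N martin_err_0_bound[of t]
        by (intro avg_mono[OF assms(1)]) (metis C_def mult_left_mono order_trans)
      also have "\<dots> = C * \<epsilon> * \<phi> 0 0" by (rule avg_1[OF assms(1)])
      also have "\<dots> \<le> (C + 1) * \<epsilon> * (\<phi> 0 0 + 1)"
        using C \<epsilon> \<phi>0 by (intro mult_mono) auto
      also have "\<dots> = r / 2"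
      proof -
        have "C + 1 \<noteq> 0" "\<phi> 0 0 + 1 \<noteq> 0" using C \<phi>0 by linarith+
        moreover have "u * (r / (2 * u * v)) * v = r / 2" if "u \<noteq> 0" "v \<noteq> 0" for u v :: real
          using that by simp
        ultimately show ?thesis unfolding \<epsilon>_def by blast
      qed
      also have "\<dots> < r" using \<open>r > 0\<close> by simp
      finally show ?thesis using avg_nonneg[OF assms(1)] by simp
    qed
    then show "\<exists>N. \<forall>n\<ge>N. norm (avg \<phi> (\<lambda>H T. \<bar>martin_err 0 t H T\<bar>) n - 0) < r" by blast
  qed
qed (fact assms(1))

lemma sum_b_le_suminf: "summable b \<Longrightarrow> finite A \<Longrightarrow> (\<Sum>j\<in>A. b j) \<le> suminf b"
  using b_nonneg by (intro sum_le_suminf) auto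

lemma bs_le:
  assumes "summable b"
  shows "bs h H k \<le> (suminf b - (\<Sum>j<h. b j)) ^ k"
proof -
  have "sum_list (map b [h..<Suc H]) = sum b {h..<Suc H}"
    by (simp add: sum_list_distinct_conv_sum_set del: upt_Suc)
  also have "\<dots> = sum b ({..<h} \<union> {h..<Suc H}) - sum b {..<h}"
    by (subst sum.union_disjoint) auto
  also have "\<dots> \<le> suminf b - sum b {..<h}"
    using sum_b_le_suminf[OF assms] by simp
  finally have "sum_list (map b [h..<Suc H]) \<le> suminf b - sum b {..<h}" .
  moreover have "0 \<le> sum_list (map b [h..<Suc H])"
    using b_nonneg by (intro sum_list_nonneg) auto
  moreover have "bs h H k \<le> sum_list (map b [h..<Suc H]) ^ k"
    unfolding bs_def using b_nonneg by (intro hsum_le_power_sum_list) auto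
  ultimately show ?thesis by (meson order_trans power_mono)
qed

text \<open>The defect is at most \<open>C / T\<close>, hence small unless the number of tails is
  below a fixed bound; the assumed limits make the weight of such positions vanish.\<close>

lemma regularI_summable:
  assumes "harmonic \<phi>" "summable b" "\<And>T. (\<lambda>H. \<phi> H T) \<longlonglongrightarrow> 0"
  shows "regular \<phi>"
  unfolding regular_def
proof (intro conjI allI)
  fix t
  define C where "C = real t * (1 / b 0) ^ t / b 0"
  have C: "C \<ge> 0" using b_nonneg by (simp add: C_def)
  have EC: "\<bar>martin_err 0 t H T\<bar> \<le> C / T" for H T
  proof -
    have "xr H T / T \<le> (1 / b 0) / T"
      using xr_le_inverse by (intro divide_right_mono) auto
    then have "real t * (1 / b 0) ^ t * (xr H T / T) \<le> real t * (1 / b 0) ^ t * ((1 / b 0) / T)"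
      using b_nonneg by (intro mult_left_mono) auto
    then show ?thesis using martin_err_0_bound[of t H T] by (simp add: C_def mult_ac)
  qed
  \<comment> \<open>Only \<open>N\<close> positions on the antidiagonal have fewer than
    \<open>N\<close> tails, and there the path sums are bounded by powers of
    \<open>suminf b\<close>.\<close>
  have lim: "avg \<phi> (\<lambda>H T. if T < N then 1 else 0) \<longlonglongrightarrow> 0" for N
  proof -
    have 1: "(\<lambda>n. \<Sum>T<N. suminf b ^ T * \<phi> (n - T) T) \<longlonglongrightarrow> (\<Sum>T<N. suminf b ^ T * 0)"
      by (intro tendsto_intros filterlim_compose[OF assms(3) filterlim_minus_const_nat_at_top])
    have "\<forall>\<^sub>F n in sequentially. norm (avg \<phi> (\<lambda>H T. if T < N then 1 else 0) n)
        \<le> (\<Sum>T<N. suminf b ^ T * \<phi> (n - T) T)"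
      using eventually_ge_at_top[of N]
    proof eventually_elim
      case (elim n)
      have "avg \<phi> (\<lambda>H T. if T < N then 1 else 0) n =
          (\<Sum>H\<in>{H\<in>{..n}. n - H < N}. d 0 0 H (n - H) * \<phi> H (n - H))"
        unfolding avg_def by (subst sum.inter_filter) (auto intro!: sum.cong)
      also have "\<dots> = (\<Sum>T<N. d 0 0 (n - T) T * \<phi> (n - T) T)"
        by (rule sum.reindex_bij_witness[of _ "\<lambda>T. n - T" "\<lambda>H. n - H"]) (use elim in auto)
      also have "\<dots> \<le> (\<Sum>T<N. suminf b ^ T * \<phi> (n - T) T)"
        using bs_le[OF assms(2), of 0] harmonic_nonneg[OF assms(1)]
        by (intro sum_mono mult_right_mono) (auto simp: d_def)
      finally show ?case using avg_nonneg[OF assms(1)] by simp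
    qed
    from Lim_null_comparison[OF this] 1 show ?thesis by simp
  qed
  show "avg \<phi> (\<lambda>H T. \<bar>martin_err 0 t H T\<bar>) \<longlonglongrightarrow> 0"
  proof (rule LIMSEQ_I)
    fix r :: real assume "r > 0"
    have \<phi>0: "\<phi> 0 0 \<ge> 0" using harmonic_nonneg[OF assms(1)] .
    define \<epsilon> where "\<epsilon> = r / (2 * (\<phi> 0 0 + 1))"
    have \<epsilon>: "\<epsilon> > 0" using \<open>r > 0\<close> \<phi>0 by (simp add: \<epsilon>_def)
    obtain N :: nat where N: "C / \<epsilon> < real N"
      using reals_Archimedean2 by blast
    have N0: "real N > 0" using N C \<epsilon> by (meson divide_nonneg_pos le_less_trans)
    have "\<exists>M. \<forall>n\<ge>M. norm (avg \<phi> (\<lambda>H T. if T < N then 1 else 0) n - 0) < r / (2 * (C + 1))"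
      using lim[of N] C \<open>r > 0\<close> by (intro LIMSEQ_D) auto
    then obtain M where M: "\<And>n. n \<ge> M \<Longrightarrow>
        avg \<phi> (\<lambda>H T. if T < N then 1 else 0) n < r / (2 * (C + 1))"
      by (auto simp: abs_less_iff)
    have "norm (avg \<phi> (\<lambda>H T. \<bar>martin_err 0 t H T\<bar>) n - 0) < r" if "n \<ge> M" for n
    proof -
      have "\<bar>martin_err 0 t H T\<bar> \<le> \<epsilon> + C * (if T < N then 1 else 0)" for H T
      proof (cases "T < N")
        case True
        \<comment> \<open>For \<open>T = 0\<close> the quotient is 0 by convention.\<close>
        have "C / T \<le> C" using C by (cases T) (auto simp: field_simps mult_nonneg_nonneg)
        then show ?thesis using True EC[of H T] \<epsilon> by simp
      next
        case False
        then have "C / T \<le> C / N" using C N0 by (intro divide_left_mono) auto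
        also have "\<dots> \<le> \<epsilon>" using N N0 \<epsilon> by (simp add: field_simps)
        finally show ?thesis using EC[of H T] False by simp
      qed
      then have "avg \<phi> (\<lambda>H T. \<bar>martin_err 0 t H T\<bar>) n \<le> avg \<phi> (\<lambda>H T. \<epsilon> + C * (if T < N then 1 else 0)) n"
        by (intro avg_mono[OF assms(1)])
      also have "\<dots> = \<epsilon> * \<phi> 0 0 + C * avg \<phi> (\<lambda>H T. if T < N then 1 else 0) n"
        using avg_1[OF assms(1)] by (simp only: avg_add avg_cmult)
      also have "\<dots> \<le> \<epsilon> * (\<phi> 0 0 + 1) + C * (r / (2 * (C + 1)))"
        using M[OF that] C \<epsilon> \<phi>0 by (intro add_mono mult_left_mono) auto
      also have "C * (r / (2 * (C + 1))) < r / 2"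
        using C \<open>r > 0\<close> by (simp add: field_simps)
      also have "\<epsilon> * (\<phi> 0 0 + 1) + r / 2 = r"
        using \<phi>0 by (simp add: \<epsilon>_def field_simps)
      finally show ?thesis using avg_nonneg[OF assms(1)] by simp
    qed
    then show "\<exists>N. \<forall>n\<ge>N. norm (avg \<phi> (\<lambda>H T. \<bar>martin_err 0 t H T\<bar>) n - 0) < r" by blast
  qed
qed (fact assms(1))

section \<open>Minimal functions and the kernels\<close>

lemma minimalD:
  assumes "minimal \<phi>"
  shows "harmonic \<phi>" "\<phi> 0 0 = 1"
    and "harmonic \<psi> \<Longrightarrow> (\<And>h t. \<psi> h t \<le> C * \<phi> h t) \<Longrightarrow> \<psi> h t = \<psi> 0 0 * \<phi> h t"
  using assms unfolding minimal_def by blast+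

lemma harmonic_shift: "harmonic \<phi> \<Longrightarrow> harmonic (\<lambda>h t. \<phi> h (Suc t))"
  unfolding harmonic_def by blast

text \<open>Regularity bounds the shifted function by a multiple of \<open>\<phi>\<close>, so
  minimality makes it proportional to \<open>\<phi>\<close>. Column 0 is then geometric, and it
  determines the other columns.\<close>

lemma minimal_regular_kern:
  assumes "minimal \<phi>" "regular \<phi>"
  obtains x where "x \<ge> 0" "\<phi> = kern x" "harmonic (kern x)"
proof -
  define x where "x = \<phi> 0 1"
  have har: "harmonic \<phi>" using minimalD[OF assms(1)] by blast
  have shift: "\<phi> h (Suc t) = x * \<phi> h t" for h t
  proof -
    have "\<phi> h (Suc t) \<le> (1 / b 0) * \<phi> h t" for h t
      using regular_shift_le[OF assms(2), of h t] b_pos[of 0] by (simp add: field_simps)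
    from minimalD(3)[OF assms(1) harmonic_shift[OF har], of "1 / b 0" h t, OF this]
    show ?thesis by (simp add: x_def)
  qed
  have eq: "\<phi> 0 t = x ^ t" for t
    by (induction t) (simp_all add: minimalD(2)[OF assms(1)] shift)
  have "\<phi> h t = kern x h t" for h t
  proof (rule harmonic_determined[of \<phi> "kern x"])
    show "\<phi> h t = \<phi> (Suc h) t + b h * \<phi> h (Suc t)" for h t by (fact harmonic_eq[OF har])
    show "kern x h t = kern x (Suc h) t + b h * kern x h (Suc t)" for h t by (fact kern_rec)
  qed (simp add: eq)
  then have \<phi>: "\<phi> = kern x" by blast
  have "x \<ge> 0" using harmonic_nonneg[OF har] by (simp add: x_def)
  from that[OF this \<phi>] show ?thesis using har unfolding \<phi> by blast
qed

text \<open>The inequality of \<open>regular_square\<close> with \<open>y = x\<close> is an equality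
  for \<open>kern x\<close>. Applied to a minorant and to its complement in
  \<open>C * kern x\<close> it therefore holds in both directions. So column 0 of the minorant
  solves a recursion with double root \<open>x\<close>, and its bounds exclude the term linear in
  \<open>t\<close>.\<close>

lemma minimal_kern:
  assumes har: "harmonic (kern x)"
    and reg: "\<And>\<psi> C. harmonic \<psi> \<Longrightarrow> (\<And>h t. \<psi> h t \<le> C * kern x h t) \<Longrightarrow> regular \<psi>"
  shows "minimal (kern x)"
  unfolding minimal_def
proof (intro conjI allI impI)
  fix \<psi> C h t assume \<psi>: "harmonic \<psi>" and "\<forall>h t. \<psi> h t \<le> C * kern x h t"
  then have le: "\<And>h t. \<psi> h t \<le> C * kern x h t" by blast
  have x: "x \<ge> 0" using harmonic_nonneg[OF har, of 0 1] by simp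
  define c where "c = \<psi> 0"
  have c: "0 \<le> c t" "c t \<le> C * x ^ t" for t
    using harmonic_nonneg[OF \<psi>] le[of 0 t] by (auto simp: c_def)
  define \<psi>' where "\<psi>' h t = C * kern x h t + (-1) * \<psi> h t" for h t
  have \<psi>': "harmonic \<psi>'"
    unfolding \<psi>'_def by (rule harmonic_lincomb[OF har \<psi>]) (simp add: le)
  have "\<psi>' h t \<le> C * kern x h t" for h t
    using harmonic_nonneg[OF \<psi>] by (simp add: \<psi>'_def)
  then have "regular \<psi>'" by (rule reg[OF \<psi>'])
  then have 1: "0 \<ge> c (Suc (Suc t)) - 2 * x * c (Suc t) + x\<^sup>2 * c t" for t
    using regular_square[of \<psi>' t x] by (simp add: \<psi>'_def c_def power2_eq_square algebra_simps)
  have "regular \<psi>" by (rule reg[OF \<psi> le])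
  then have 2: "0 \<le> c (Suc (Suc t)) - 2 * x * c (Suc t) + x\<^sup>2 * c t" for t
    using regular_square[of \<psi> t x] by (simp add: c_def)
  have eq: "c (Suc (Suc t)) - x * c (Suc t) = x * (c (Suc t) - x * c t)" for t
    using 1[of t] 2[of t] by (simp add: power2_eq_square algebra_simps)
  \<comment> \<open>The coefficient of the non-geometric part of the solution; it has to be shown to
    vanish.\<close>
  define e where "e = c 1 - x * c 0"
  have ce: "c (Suc t) - x * c t = x ^ t * e" for t
    by (induction t) (simp_all add: e_def eq mult.assoc)
  have "e = 0"
  proof (cases "x = 0")
    case True
    then show ?thesis using c[of 1] by (simp add: e_def)
  next
    case False
    with x have x: "x > 0" by simp
    \<comment> \<open>Multiplication by \<open>x\<close> avoids the exponent
      \<open>t - 1\<close>.\<close>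
    have "x * c t = x ^ t * (c 0 * x + real t * e)" for t
    proof (induction t)
      case (Suc t)
      have "x * c (Suc t) = x * (x ^ t * e + x * c t)" using ce[of t] by simp
      also have "\<dots> = x * (x ^ t * e + x ^ t * (c 0 * x + real t * e))" by (simp add: Suc)
      finally show ?case by (simp add: algebra_simps)
    qed simp
    then have cx: "c t = x ^ t * (c 0 * x + real t * e) / x" for t
      using x by (metis nonzero_mult_div_cancel_left less_irrefl)
    have *: "0 \<le> c 0 * x + real t * e" "c 0 * x + real t * e \<le> C * x" for t
    proof -
      have p: "0 < x ^ t" using x by simp
      have "0 \<le> x ^ t * (c 0 * x + real t * e) / x" using c(1)[of t] cx[of t] by simp
      then show "0 \<le> c 0 * x + real t * e" using x p by (simp add: zero_le_mult_iff zero_le_divide_iff)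
      have "x ^ t * (c 0 * x + real t * e) \<le> x ^ t * (C * x)"
        using c(2)[of t] cx[of t] x by (simp add: field_simps)
      then show "c 0 * x + real t * e \<le> C * x" using p by (simp only: mult_le_cancel_left_pos)
    qed
    have "\<bar>e\<bar> * real t \<le> \<bar>c 0 * x\<bar> + \<bar>C * x\<bar>" for t
      using *[of t] by (cases "e \<ge> 0") (auto simp: mult.commute)
    then show ?thesis using ex_less_of_nat_mult[of "\<bar>e\<bar>" "\<bar>c 0 * x\<bar> + \<bar>C * x\<bar>"]
      by (auto simp: not_less[symmetric] mult.commute)
  qed
  then have eq: "c t = c 0 * x ^ t" for t
    by (induction t) (use ce in \<open>auto simp: mult_ac\<close>)
  show "\<psi> h t = \<psi> 0 0 * kern x h t"
  proof (rule harmonic_determined[of \<psi> "\<lambda>h t. \<psi> 0 0 * kern x h t"])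
    show "\<psi> h t = \<psi> (Suc h) t + b h * \<psi> h (Suc t)" for h t by (fact harmonic_eq[OF \<psi>])
    show "\<psi> 0 0 * kern x h t = \<psi> 0 0 * kern x (Suc h) t + b h * (\<psi> 0 0 * kern x h (Suc t))" for h t
      by (subst kern_rec) (simp add: algebra_simps)
    show "\<psi> 0 t = \<psi> 0 0 * kern x 0 t" for t using eq[of t] unfolding c_def by simp
  qed
qed (use har in auto)

section \<open>Minimal harmonic functions\<close>

text \<open>At the first index \<open>m\<close> with \<open>b m * x \<ge> 1\<close> the product
  would turn negative unless equality holds, and equality makes \<open>b m\<close> a record.\<close>

lemma harmonic_kern_cases:
  assumes "harmonic (kern x)"
  obtains "\<And>j. b j * x < 1" | m where "\<And>j. j < m \<Longrightarrow> b j < b m" "x = 1 / b m"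
proof (cases "\<forall>j. b j * x < 1")
  case False
  define m where "m = (LEAST j. b j * x \<ge> 1)"
  have m: "b m * x \<ge> 1"
    using LeastI_ex[of "\<lambda>j. b j * x \<ge> 1"] False by (auto simp: m_def not_less)
  have lt: "b j * x < 1" if "j < m" for j
    using that unfolding m_def by (metis not_le not_less_Least)
  have x: "x > 0" using m b_pos[of m] by (smt (verit, best) mult_nonneg_nonpos2 mult.commute)
  have "(\<Prod>j<m. 1 - b j * x) > 0" using lt by (intro prod_pos) auto
  moreover have "0 \<le> (\<Prod>j<m. 1 - b j * x) * (1 - b m * x)"
    using harmonic_nonneg[OF assms, of "Suc m" 0] by (simp add: kern_def)
  ultimately have "b m * x = 1" using m by (simp add: zero_le_mult_iff)
  then have xm: "x = 1 / b m" using b_pos[of m] by (simp add: field_simps)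
  moreover have "b j < b m" if "j < m" for j
    using lt[OF that] b_pos[of m] by (simp add: xm)
  ultimately show ?thesis using that(2) by blast
qed (use that in blast)

lemma harmonic_kern_le:
  assumes "x \<ge> 0" "\<And>j. b j * x \<le> 1"
  shows "harmonic (kern x)"
  using assms by (intro harmonic_kern prod_nonneg) auto

context
  fixes m assumes rec: "\<And>j. j < m \<Longrightarrow> b j < b m"
begin

lemma kern_record_pos: "h \<le> m \<Longrightarrow> kern (1 / b m) h t > 0"
  unfolding kern_def using rec b_pos by (intro mult_pos_pos prod_pos) auto

lemma kern_record_zero: "m < h \<Longrightarrow> kern (1 / b m) h t = 0"
  unfolding kern_def using b_pos[of m] by (auto intro!: bexI[of _ m])

lemma harmonic_kern_record: "harmonic (kern (1 / b m))"
proof (rule harmonic_kern)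
  show "0 \<le> (\<Prod>j<h. 1 - b j * (1 / b m))" for h
  proof -
    have "(\<Prod>j<h. 1 - b j * (1 / b m)) = kern (1 / b m) h 0" unfolding kern_def by simp
    then show ?thesis using kern_record_pos[of h 0] kern_record_zero[of h 0]
      by (metis less_imp_le not_le order_refl)
  qed
qed (use b_nonneg in simp)

text \<open>A minorant vanishes beyond column \<open>m\<close>, which supplies the limits for
  \<open>regularI_summable\<close>; if \<open>b\<close> is not summable, the other criterion
  applies.\<close>

lemma minimal_kern_record: "minimal (kern (1 / b m))"
proof (rule minimal_kern[OF harmonic_kern_record])
  fix \<psi> C assume \<psi>: "harmonic \<psi>" and le: "\<And>h t. \<psi> h t \<le> C * kern (1 / b m) h t"
  show "regular \<psi>"
  proof (cases "summable b")
    case True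
    have "\<psi> H T = 0" if "m < H" for H T
      using le[of H T] harmonic_nonneg[OF \<psi>, of H T] kern_record_zero[OF that] by simp
    then have "(\<lambda>H. \<psi> H T) \<longlonglongrightarrow> 0" for T
      by (intro tendsto_eventually) (auto intro: eventually_mono[OF eventually_gt_at_top[of m]])
    then show ?thesis by (intro regularI_summable \<psi> True)
  qed (intro regularI_not_summable \<psi>)
qed

text \<open>The ratios \<open>rho m\<close> decrease to some \<open>\<rho> \<ge> b m\<close>, and
  since the defects vanish, the kernels converge to \<open>kern (1 / \<rho>)\<close>. It remains to
  identify \<open>\<rho>\<close>.\<close>

lemma martin_tendsto_record: "(\<lambda>T. martin h t m T) \<longlonglongrightarrow> kern (1 / b m) h t"
proof -
  have dec: "decseq (rho m)" by (rule antimonoI) (rule rho_antimono)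
  obtain \<rho> where \<rho>: "rho m \<longlonglongrightarrow> \<rho>" "\<And>i. \<rho> \<le> rho m i"
    using decseq_convergent[OF dec, of 0] rho_pos by (metis less_imp_le)
  have \<rho>m: "b m \<le> \<rho>" by (rule LIMSEQ_le_const[OF \<rho>(1)]) (use rho_ge in blast)
  then have \<rho>0: "\<rho> > 0" using b_pos[of m] by linarith
  have "(\<lambda>T. 1 / rho m T) \<longlonglongrightarrow> 1 / \<rho>" using \<rho>0 by (intro tendsto_intros \<rho>) auto
  then have xr: "(\<lambda>T. xr m T) \<longlonglongrightarrow> 1 / \<rho>"
    by (subst filterlim_sequentially_Suc[symmetric]) (simp add: xr_Suc)
  have martin_err: "(\<lambda>T. martin_err 0 t m T) \<longlonglongrightarrow> 0" for t
  proof (rule Lim_null_comparison)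
    have "\<bar>martin_err 0 t m T\<bar> \<le> (real t * (1 / b 0) ^ t * (1 / b 0)) * (1 / real T)" for T
    proof -
      have "xr m T / T \<le> (1 / b 0) / T"
        using xr_le_inverse by (intro divide_right_mono) auto
      then have "real t * (1 / b 0) ^ t * (xr m T / T) \<le> real t * (1 / b 0) ^ t * ((1 / b 0) / T)"
        using b_nonneg by (intro mult_left_mono) auto
      then show ?thesis using martin_err_0_bound[of t m T] by simp
    qed
    then show "\<forall>\<^sub>F T in sequentially. norm (martin_err 0 t m T) \<le>
        (real t * (1 / b 0) ^ t * (1 / b 0)) * (1 / real T)" by simp
    show "(\<lambda>T. (real t * (1 / b 0) ^ t * (1 / b 0)) * (1 / real T)) \<longlonglongrightarrow> 0"
      by (rule tendsto_mult_right_zero) (rule lim_1_over_n)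
  qed
  have lim: "(\<lambda>T. martin h t m T) \<longlonglongrightarrow> kern (1 / \<rho>) h t" for h t
  proof (induction h arbitrary: t)
    case 0
    show ?case
    proof (induction t)
      case (Suc t)
      have "(\<lambda>T. martin_err 0 t m T + xr m T * martin 0 t m T) \<longlonglongrightarrow> 0 + 1 / \<rho> * kern (1 / \<rho>) 0 t"
        by (intro tendsto_intros martin_err xr Suc)
      then show ?case by (simp add: martin_err_def)
    qed (simp add: martin_0_0)
  next
    case (Suc h)
    have "(\<lambda>T. martin h t m T - b h * martin h (Suc t) m T) \<longlonglongrightarrow>
        kern (1 / \<rho>) h t - b h * kern (1 / \<rho>) h (Suc t)"
      by (intro tendsto_intros Suc)
    moreover have "\<forall>\<^sub>F T in sequentially. martin h t m T - b h * martin h (Suc t) m T = martin (Suc h) t m T"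
      using eventually_gt_at_top[of t] by eventually_elim (subst martin_rec, auto)
    ultimately show ?case
      using kern_rec[of "1 / \<rho>" h t] by (simp add: Lim_transform_eventually)
  qed
  \<comment> \<open>No path leads from column \<open>m + 1\<close> back to column \<open>m\<close>,
    so the limit vanishes there and some factor of its product is 0. Hence \<open>\<rho>\<close> is
    one of \<open>b 0, ..., b m\<close>, and being at least the record \<open>b m\<close> it equals
    it.\<close>
  have "(\<lambda>T. martin (Suc m) 0 m T) \<longlonglongrightarrow> 0" by (simp add: martin_def d_def)
  then have "kern (1 / \<rho>) (Suc m) 0 = 0" using lim LIMSEQ_unique by blast
  then have "\<exists>j\<in>{..<Suc m}. 1 - b j * (1 / \<rho>) = 0"
    unfolding kern_def by (simp del: prod.lessThan_Suc)
  then obtain j where j: "j < Suc m" "1 - b j * (1 / \<rho>) = 0" by blast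
  then have "b j = \<rho>" "j \<le> m" using \<rho>0 by (simp_all add: field_simps)
  then have "\<rho> = b m" using \<rho>m rec[of j] by (cases "j = m") auto
  then show ?thesis using lim by simp
qed

end

lemma minimal_kern_not_summable:
  assumes "\<not> summable b" "harmonic (kern x)"
  shows "minimal (kern x)"
  using assms by (intro minimal_kern regularI_not_summable) auto

text \<open>Positivity of the infinite product: beyond an index \<open>N\<close> the sum of the
  terms \<open>b j * x\<close> is below 1/2, and Weierstrass' inequality bounds the remaining
  product by 1 minus that sum.\<close>

lemma prod_lower_bound:
  assumes "summable b" "x \<ge> 0" "\<And>j. b j * x < 1"
  obtains c where "c > 0" "\<And>h. c \<le> (\<Prod>j<h. 1 - b j * x)"
proof -
  have sum: "summable (\<lambda>j. b j * x)" by (intro summable_mult2 assms)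
  have nn: "0 \<le> b j * x" for j using b_nonneg assms(2) by simp
  obtain N where N: "(\<Sum>i. b (i + N) * x) < 1 / 2"
    using suminf_exist_split[OF _ sum, of "1 / 2"]
    by (metis abs_less_iff half_gt_zero_iff order_refl real_norm_def zero_less_one)
  define p where "p h = (\<Prod>j<h. 1 - b j * x)" for h
  have p: "p h > 0" for h unfolding p_def using assms(3) by (intro prod_pos) auto
  have split: "p N * (1 - (\<Sum>i<k. b (i + N) * x)) \<le> p (N + k)" for k
  proof (induction k)
    case (Suc k)
    let ?S = "\<Sum>i<k. b (i + N) * x" and ?a = "b (k + N) * x"
    have S: "0 \<le> ?S * ?a" by (rule mult_nonneg_nonneg[OF sum_nonneg]) (rule nn)+
    have "p N * (1 - (?S + ?a)) \<le> p N * ((1 - ?S) * (1 - ?a))"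
      using p[of N] S by (intro mult_left_mono) (auto simp: algebra_simps)
    also have "\<dots> \<le> p (N + k) * (1 - ?a)"
      using Suc assms(3)[of "k + N"] by (simp add: mult.assoc[symmetric] mult_right_mono)
    also have "\<dots> = p (N + Suc k)" by (simp add: p_def add.commute)
    finally show ?case by simp
  qed simp
  have "p N / 2 \<le> p h" for h
  proof -
    have "(\<Sum>i<h. b (i + N) * x) \<le> (\<Sum>i. b (i + N) * x)"
      using nn by (intro sum_le_suminf summable_ignore_initial_segment sum) auto
    then have "p N * (1 / 2) \<le> p N * (1 - (\<Sum>i<h. b (i + N) * x))"
      using N p[of N] by (intro mult_left_mono) auto
    also have "\<dots> \<le> p (N + h)" by (rule split)
    also have "\<dots> \<le> p h"
    proof -
      have "decseq p"
        using p nn by (intro decseq_SucI) (simp add: p_def mult_left_le less_imp_le)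
      then show ?thesis by (simp add: decseqD)
    qed
    finally show ?thesis by simp
  qed
  then show ?thesis using that[of "p N / 2"] p[of N] by (simp add: p_def)
qed

text \<open>The path of heads only has positive probability, so its function \<open>kern 0\<close>
  is dominated by a multiple of \<open>kern x\<close>; the two are not proportional, as their values
  at \<open>(0, 1)\<close> show.\<close>

lemma not_minimal_kern:
  assumes "summable b" "x > 0" "\<And>j. b j * x < 1"
  shows "\<not> minimal (kern x)"
proof
  assume min: "minimal (kern x)"
  obtain c where c: "c > 0" "\<And>h. c \<le> (\<Prod>j<h. 1 - b j * x)"
    using prod_lower_bound[OF assms(1) _ assms(3)] assms(2) by auto
  have "harmonic (kern 0)" by (intro harmonic_kern_le) auto
  moreover have "kern 0 h t \<le> (1 / c) * kern x h t" for h t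
  proof (cases "t = 0")
    case True
    then show ?thesis using c(1) c(2)[of h] by (simp add: kern_def field_simps)
  next
    case False
    have "(\<Prod>j<h. 1 - b j * x) \<ge> 0" using c(1) c(2)[of h] by linarith
    then show ?thesis using False c(1) assms(2) by (simp add: kern_def zero_power)
  qed
  ultimately have "kern 0 0 1 = kern 0 0 0 * kern x 0 1" by (rule minimalD(3)[OF min])
  then show False using assms(2) by simp
qed

section \<open>Symmetric polynomials in infinitely many variables and the functions of
  \<open>Q_right\<close>\<close>

definition hsum_inf :: "nat \<Rightarrow> nat \<Rightarrow> real" where
  "hsum_inf h k = lim (\<lambda>H. bs h H k)"

text \<open>The limit of the Martin kernels whose poles move to the right along row
  \<open>m\<close>, see \<open>martin_tendsto_Q\<close>.\<close>

definition Q :: "nat \<Rightarrow> nat \<Rightarrow> nat \<Rightarrow> real" where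
  "Q m h t = (if t \<le> m then hsum_inf h (m - t) / hsum_inf 0 m else 0)"

context
  assumes summable: "summable b"
begin

lemma incseq_bs: "incseq (\<lambda>H. bs h H k)"
  by (intro incseq_SucI bs_Suc_le)

lemma hsum_inf_tendsto: "(\<lambda>H. bs h H k) \<longlonglongrightarrow> hsum_inf h k"
proof -
  have "convergent (\<lambda>H. bs h H k)"
    using incseq_convergent[OF incseq_bs] bs_le[OF summable] by (metis convergentI)
  then show ?thesis unfolding hsum_inf_def by (simp add: convergent_LIMSEQ_iff)
qed

lemma bs_le_hsum_inf: "bs h H k \<le> hsum_inf h k"
  by (rule incseq_le[OF incseq_bs hsum_inf_tendsto])

lemma hsum_inf_0 [simp]: "hsum_inf h 0 = 1"
  using hsum_inf_tendsto[of h 0] by (simp add: LIMSEQ_const_iff)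

lemma hsum_inf_pos: "hsum_inf h k > 0"
  using bs_le_hsum_inf[of h h k] bs_pos[of h h k] by simp

lemma hsum_inf_le: "hsum_inf h k \<le> (suminf b - (\<Sum>j<h. b j)) ^ k"
  by (rule LIMSEQ_le_const2[OF hsum_inf_tendsto]) (use bs_le[OF summable] in blast)

lemma hsum_inf_Suc: "hsum_inf h (Suc k) = hsum_inf (Suc h) (Suc k) + b h * hsum_inf h k"
proof (rule LIMSEQ_unique[OF hsum_inf_tendsto])
  have "(\<lambda>H. bs (Suc h) H (Suc k) + b h * bs h H k) \<longlonglongrightarrow> hsum_inf (Suc h) (Suc k) + b h * hsum_inf h k"
    by (intro tendsto_intros hsum_inf_tendsto)
  moreover have "\<forall>\<^sub>F H in sequentially. bs (Suc h) H (Suc k) + b h * bs h H k = bs h H (Suc k)"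
    using eventually_ge_at_top[of h] by eventually_elim (simp add: bs_Suc)
  ultimately show "(\<lambda>H. bs h H (Suc k)) \<longlonglongrightarrow> hsum_inf (Suc h) (Suc k) + b h * hsum_inf h k"
    by (rule Lim_transform_eventually)
qed

lemma hsum_inf_vanish:
  assumes "k > 0" shows "(\<lambda>h. hsum_inf h k) \<longlonglongrightarrow> 0"
proof (rule Lim_null_comparison)
  show "\<forall>\<^sub>F h in sequentially. norm (hsum_inf h k) \<le> (suminf b - (\<Sum>j<h. b j)) ^ k"
    using hsum_inf_le hsum_inf_pos by (simp add: less_imp_le)
  have "(\<lambda>h. suminf b - (\<Sum>j<h. b j)) \<longlonglongrightarrow> suminf b - suminf b"
    by (intro tendsto_intros summable_LIMSEQ summable)
  then show "(\<lambda>h. (suminf b - (\<Sum>j<h. b j)) ^ k) \<longlonglongrightarrow> 0"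
    using assms by (intro tendsto_null_power) auto
qed

text \<open>The factor \<open>c\<close> is left free: the normalized \<open>Q m\<close> and the
  minorant built in \<open>minimal_summable_cases\<close> are both instances.\<close>

lemma harmonic_hsum_inf: "c \<ge> 0 \<Longrightarrow> harmonic (\<lambda>h t. if t \<le> m then c * hsum_inf h (m - t) else 0)"
  unfolding harmonic_def
proof (intro conjI allI)
  fix h t
  have "m - t = Suc (m - Suc t)" if "t < m" using that by simp
  then show "(if t \<le> m then c * hsum_inf h (m - t) else 0) = (if t \<le> m then c * hsum_inf (Suc h) (m - t) else 0) +
      b h * (if Suc t \<le> m then c * hsum_inf h (m - Suc t) else 0)"
    using hsum_inf_Suc[of h "m - Suc t"] by (auto simp: algebra_simps not_less_eq_eq le_less)
qed (use hsum_inf_pos in \<open>simp add: less_imp_le\<close>)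

lemma harmonic_Q: "harmonic (Q m)"
proof -
  have "Q m = (\<lambda>h t. if t \<le> m then 1 / hsum_inf 0 m * hsum_inf h (m - t) else 0)"
    by (simp add: Q_def fun_eq_iff)
  then show ?thesis using harmonic_hsum_inf[of "1 / hsum_inf 0 m" m] hsum_inf_pos[of 0 m] by simp
qed

lemma Q_0_0: "Q m 0 0 = 1"
  using hsum_inf_pos[of 0 m] by (simp add: Q_def)

lemma Q_pos: "t \<le> m \<Longrightarrow> Q m h t > 0"
  using hsum_inf_pos by (simp add: Q_def)

lemma Q_zero: "m < t \<Longrightarrow> Q m h t = 0"
  by (simp add: Q_def)

lemma martin_tendsto_Q: "(\<lambda>H. martin h t H m) \<longlonglongrightarrow> Q m h t"
proof (cases "t \<le> m")
  case True
  have "(\<lambda>H. bs h H (m - t) / bs 0 H m) \<longlonglongrightarrow> hsum_inf h (m - t) / hsum_inf 0 m"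
    using hsum_inf_pos[of 0 m] by (intro tendsto_intros hsum_inf_tendsto) auto
  moreover have "\<forall>\<^sub>F H in sequentially. bs h H (m - t) / bs 0 H m = martin h t H m"
    using eventually_ge_at_top[of h] by eventually_elim (simp add: martin_def d_def True)
  ultimately show ?thesis using True by (simp add: Q_def Lim_transform_eventually)
qed (simp add: martin_def Q_def d_def)

text \<open>Rows are treated from the top down. Once the difference \<open>D\<close> vanishes in row
  \<open>t + 1\<close>, it is constant along row \<open>t\<close>; for \<open>t = m\<close> the
  constant is 0 by the choice of \<open>\<alpha>\<close>, and for \<open>t < m\<close> because both
  functions tend to 0 along the row.\<close>

lemma minimal_Q: "minimal (Q m)"
  unfolding minimal_def
proof (intro conjI allI impI)
  fix \<psi> C h t assume \<psi>: "harmonic \<psi>" and "\<forall>h t. \<psi> h t \<le> C * Q m h t"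
  then have le: "\<And>h t. \<psi> h t \<le> C * Q m h t" by blast
  have top: "\<psi> h t = 0" if "m < t" for h t
    using le[of h t] harmonic_nonneg[OF \<psi>, of h t] Q_zero[OF that, of h] by simp
  define \<alpha> where "\<alpha> = \<psi> 0 m * hsum_inf 0 m"
  define D where "D h t = \<psi> h t - \<alpha> * Q m h t" for h t
  have D_rec: "D h t = D (Suc h) t + b h * D h (Suc t)" for h t
    unfolding D_def by (subst harmonic_eq[OF \<psi>], subst harmonic_eq[OF harmonic_Q])
      (simp add: algebra_simps)
  have D: "D h t = 0" for h t
  \<comment> \<open>The base case is \<open>t > m\<close>, where both functions are 0.\<close>
  proof (induction "Suc m - t" arbitrary: h t)
    case 0
    then show ?case using top[of t h] Q_zero[of m t h] by (simp add: D_def)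
  next
    case (Suc k)
    have D0: "D h (Suc t) = 0" for h using Suc.hyps(1)[of "Suc t"] Suc.hyps(2) by simp
    have const: "D h t = D 0 t" for h
    proof (induction h)
      case (Suc h)
      then show ?case using D_rec[of h t] D0[of h] by simp
    qed simp
    show ?case
    proof (cases "t = m")
      case True
      have "D 0 m = 0" using hsum_inf_pos[of 0 m] by (simp add: D_def \<alpha>_def Q_def)
      then show ?thesis using const True by simp
    next
      case False
      then have t: "t < m" using Suc.hyps(2) by simp
      have Q: "(\<lambda>h. Q m h t) \<longlonglongrightarrow> 0"
        using tendsto_divide[OF hsum_inf_vanish[of "m - t"] tendsto_const, of "hsum_inf 0 m"] t hsum_inf_pos[of 0 m]
        by (simp add: Q_def)
      have "(\<lambda>h. \<psi> h t) \<longlonglongrightarrow> 0"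
      proof (rule tendsto_sandwich[where f = "\<lambda>_. 0" and h = "\<lambda>h. C * Q m h t"])
        show "(\<lambda>h. C * Q m h t) \<longlonglongrightarrow> 0" by (rule tendsto_mult_right_zero[OF Q])
      qed (simp_all add: le harmonic_nonneg[OF \<psi>])
      then have "(\<lambda>h. D h t) \<longlonglongrightarrow> 0 - \<alpha> * 0"
        unfolding D_def by (intro tendsto_intros Q)
      moreover have "(\<lambda>h. D h t) = (\<lambda>_. D 0 t)" using const by blast
      ultimately have "D 0 t = 0" by (simp add: LIMSEQ_const_iff)
      then show ?thesis using const[of h] by simp
    qed
  qed
  have "\<alpha> = \<psi> 0 0" using D[of 0 0] by (simp add: D_def Q_0_0)
  then show "\<psi> h t = \<psi> 0 0 * Q m h t" using D[of h t] by (simp add: D_def)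
qed (simp_all add: harmonic_Q Q_0_0)

text \<open>The limits \<open>l T\<close> along the rows decide. If \<open>l m > 0\<close>, the path
  remains in row \<open>m\<close> forever with positive probability, and \<open>\<phi>\<close>
  dominates a multiple of \<open>Q m\<close>. If all limits are 0, then \<open>\<phi>\<close> is
  regular and hence a kernel.\<close>

lemma minimal_summable_cases:
  assumes "minimal \<phi>"
  obtains m where "\<phi> = Q m" | m where "\<And>j. j < m \<Longrightarrow> b j < b m" "\<phi> = kern (1 / b m)"
proof -
  have har: "harmonic \<phi>" using minimalD[OF assms] by blast
  have "\<exists>l\<ge>0. (\<lambda>H. \<phi> H T) \<longlonglongrightarrow> l \<and> (\<forall>H. l \<le> \<phi> H T)" for T
  proof -
    have "decseq (\<lambda>H. \<phi> H T)" by (intro decseq_SucI harmonic_Suc_le har)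
    from decseq_convergent[OF this, of 0] harmonic_nonneg[OF har]
    obtain l where "(\<lambda>H. \<phi> H T) \<longlonglongrightarrow> l" "\<And>H. l \<le> \<phi> H T" by metis
    then show ?thesis using LIMSEQ_le_const[of "\<lambda>H. \<phi> H T" l 0] harmonic_nonneg[OF har] by auto
  qed
  then obtain l where l: "\<And>T. l T \<ge> 0" "\<And>T. (\<lambda>H. \<phi> H T) \<longlonglongrightarrow> l T" "\<And>H T. l T \<le> \<phi> H T" by metis
  show ?thesis
  proof (cases "\<exists>m. l m > 0")
    case True
    then obtain m where m: "l m > 0" by blast
    \<comment> \<open>The lower bound that results from
      \<open>d h t H m * \<phi> H m \<le> \<phi> h t\<close> as \<open>H\<close> tends to
      infinity.\<close>
    define \<psi> where "\<psi> h t = (if t \<le> m then l m * hsum_inf h (m - t) else 0)" for h t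
    have \<psi>: "harmonic \<psi>" unfolding \<psi>_def using l(1) by (rule harmonic_hsum_inf)
    have le: "\<psi> h t \<le> 1 * \<phi> h t" for h t
    proof (cases "t \<le> m")
      case True
      have "(\<lambda>H. l m * bs h H (m - t)) \<longlonglongrightarrow> l m * hsum_inf h (m - t)"
        by (intro tendsto_intros hsum_inf_tendsto)
      moreover have "\<exists>N. \<forall>H\<ge>N. l m * bs h H (m - t) \<le> \<phi> h t"
      proof (intro exI allI impI)
        fix H assume "H \<ge> h"
        then have "l m * bs h H (m - t) \<le> d h t H m * \<phi> H m"
          using True mult_right_mono[OF l(3)[of m H] bs_nonneg[of h H "m - t"]] by (simp add: d_def mult.commute)
        also have "\<dots> \<le> \<phi> h t" by (rule harmonic_ge[OF har])
        finally show "l m * bs h H (m - t) \<le> \<phi> h t" .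
      qed
      ultimately show ?thesis using True by (simp add: \<psi>_def LIMSEQ_le_const2)
    qed (simp add: \<psi>_def harmonic_nonneg[OF har])
    have eq: "\<psi> h t = \<psi> 0 0 * \<phi> h t" for h t by (rule minimalD(3)[OF assms \<psi> le])
    have "\<psi> 0 0 = l m * hsum_inf 0 m" by (simp add: \<psi>_def)
    then have "\<phi> h t = Q m h t" for h t
      using eq[of h t] m hsum_inf_pos[of 0 m] by (auto simp: \<psi>_def Q_def field_simps)
    then show ?thesis using that(1)[of m] by blast
  next
    case False
    then have l0: "l T = 0" for T using l(1)[of T] by (meson antisym not_le)
    then have "regular \<phi>" using l(2) by (intro regularI_summable har summable) simp
    from minimal_regular_kern[OF assms this] obtain x
      where x: "x \<ge> 0" "\<phi> = kern x" "harmonic (kern x)" by blast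
    from x(3) show ?thesis
    proof (cases rule: harmonic_kern_cases)
      case 1
      from prod_lower_bound[OF summable x(1) this] obtain c
        where c: "c > 0" "\<And>h. c \<le> (\<Prod>j<h. 1 - b j * x)" by blast
      \<comment> \<open>A kernel without zero factor keeps positive weight along row 0, against
        \<open>l 0 = 0\<close>; only the records are left.\<close>
      have "c \<le> l 0" by (rule LIMSEQ_le_const[OF l(2)]) (use c x(2) in \<open>auto simp: kern_def\<close>)
      then show ?thesis using l0 c(1) by simp
    next
      case (2 m)
      then show ?thesis using that(2) x(2) by blast
    qed
  qed
qed

section \<open>The reciprocals of the values \<open>Q (Suc k) 0 1\<close> and their limit\<close>

definition hsum_ratio :: "nat \<Rightarrow> real" where
  "hsum_ratio k = hsum_inf 0 (Suc k) / hsum_inf 0 k"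

lemma rho_tendsto_hsum_ratio: "(\<lambda>H. rho H k) \<longlonglongrightarrow> hsum_ratio k"
  unfolding rho_def hsum_ratio_def using hsum_inf_pos[of 0 k] by (intro tendsto_intros hsum_inf_tendsto) auto

lemma decseq_hsum_ratio: "decseq hsum_ratio"
  by (rule antimonoI) (rule LIMSEQ_le[OF rho_tendsto_hsum_ratio rho_tendsto_hsum_ratio], use rho_antimono in blast)

text \<open>Strictness comes from the monomial \<open>b i ^ Suc k\<close> of a second variable,
  which does not depend on \<open>H\<close> and so survives the limit. It keeps the first-head
  probabilities away from their limit.\<close>

lemma hsum_ratio_gt: "b j < hsum_ratio k"
proof -
  define i where "i = (if j = 0 then 1 else 0 :: nat)"
  have "b j * bs 0 H k + b i ^ Suc k \<le> bs 0 H (Suc k)" if "i + j \<le> H" for H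
  proof -
    define us vs where "us = map b [0..<j]" and "vs = map b [Suc j..<Suc H]"
    have "[0..<Suc H] = [0..<j] @ j # [Suc j..<Suc H]"
      using that upt_add_eq_append[of 0 j "Suc H - j"] upt_conv_Cons[of j "Suc H"] by simp
    then have eq: "map b [0..<Suc H] = us @ b j # vs"
      unfolding us_def vs_def by (metis list.simps(9) map_append)
    have "b i \<in> set (us @ vs)"
      using that by (auto simp: us_def vs_def i_def simp del: upt_Suc split: if_splits)
    moreover have "x \<ge> 0" if "x \<in> set (us @ vs)" for x
      using that b_nonneg by (auto simp: us_def vs_def)
    ultimately have "b i ^ Suc k \<le> hsum (us @ vs) (Suc k)"
      by (intro hsum_ge_power) auto
    then show ?thesis unfolding bs_def eq hsum_remove by simp
  qed
  then have "\<exists>N. \<forall>H\<ge>N. b j * bs 0 H k + b i ^ Suc k \<le> bs 0 H (Suc k)" by blast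
  then have "b j * hsum_inf 0 k + b i ^ Suc k \<le> hsum_inf 0 (Suc k)"
    by (rule LIMSEQ_le[OF tendsto_add[OF tendsto_mult_left[OF hsum_inf_tendsto] tendsto_const] hsum_inf_tendsto])
  moreover have "b i ^ Suc k > 0" using b_pos by simp
  ultimately have "b j * hsum_inf 0 k < hsum_inf 0 (Suc k)" by linarith
  then show ?thesis using hsum_inf_pos[of 0 k] by (simp add: hsum_ratio_def field_simps)
qed

text \<open>Growth rates are compared. A limit \<open>\<rho> > B\<close> would give
  \<open>hsum_inf 0 k \<ge> \<rho> ^ k\<close>, while for \<open>z\<close> strictly between
  \<open>B\<close> and \<open>\<rho>\<close> the harmonic function \<open>kern (1 / z)\<close> with
  its product bound gives \<open>hsum_inf 0 k \<le> z ^ k / c\<close>.\<close>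

lemma hsum_ratio_tendsto:
  assumes B: "\<And>j. b j \<le> B" "B = b m"
  shows "hsum_ratio \<longlonglongrightarrow> B"
proof -
  obtain \<rho> where \<rho>: "hsum_ratio \<longlonglongrightarrow> \<rho>" "\<And>i. \<rho> \<le> hsum_ratio i"
    using decseq_convergent[OF decseq_hsum_ratio, of B] hsum_ratio_gt[of m] B(2) by (metis less_imp_le)
  have "B \<le> \<rho>" by (rule LIMSEQ_le_const[OF \<rho>(1)]) (use hsum_ratio_gt[of m] B(2) in \<open>auto intro: less_imp_le\<close>)
  moreover have "\<rho> \<le> B"
  proof (rule ccontr)
    assume "\<not> \<rho> \<le> B"
    then obtain z where z: "B < z" "z < \<rho>" using dense[of B \<rho>] by auto
    have B0: "B > 0" using b_pos B(2) by simp
    define x where "x = 1 / z"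
    have x: "x > 0" "\<And>j. b j * x < 1"
      using z B0 B(1) by (auto simp: x_def field_simps intro: le_less_trans)
    from prod_lower_bound[OF summable _ x(2)] x(1) obtain c
      where c: "c > 0" "\<And>h. c \<le> (\<Prod>j<h. 1 - b j * x)" by (metis less_imp_le)
    have har: "harmonic (kern x)" using x by (intro harmonic_kern_le) (auto intro: less_imp_le)
    have 1: "hsum_inf 0 k * (x ^ k * c) \<le> 1" for k
    proof (rule LIMSEQ_le_const2)
      show "(\<lambda>H. bs 0 H k * (x ^ k * c)) \<longlonglongrightarrow> hsum_inf 0 k * (x ^ k * c)"
        by (intro tendsto_intros hsum_inf_tendsto)
      have "bs 0 H k * (x ^ k * c) \<le> 1" for H
      proof -
        have "bs 0 H k * (x ^ k * c) \<le> d 0 0 H k * kern x H k"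
          using c(2)[of H] x(1) bs_nonneg by (simp add: d_def kern_def mult_left_mono)
        also have "\<dots> \<le> 1" using harmonic_ge[OF har, of 0 0 H k] by simp
        finally show ?thesis .
      qed
      then show "\<exists>N. \<forall>H\<ge>N. bs 0 H k * (x ^ k * c) \<le> 1" by blast
    qed
    have 2: "\<rho> ^ k \<le> hsum_inf 0 k" for k
    proof (induction k)
      case (Suc k)
      have "\<rho> * \<rho> ^ k \<le> hsum_ratio k * hsum_inf 0 k"
        using \<rho>(2)[of k] Suc z B0 hsum_inf_pos[of 0 k] by (intro mult_mono) auto
      then show ?case using hsum_inf_pos[of 0 k] by (simp add: hsum_ratio_def)
    qed simp
    have "(\<rho> * x) ^ k \<le> 1 / c" for k
    proof -
      have "\<rho> ^ k * (x ^ k * c) \<le> hsum_inf 0 k * (x ^ k * c)"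
        using 2 x(1) c(1) by (intro mult_right_mono) auto
      also have "\<dots> \<le> 1" by (rule 1)
      finally have "(\<rho> * x) ^ k * c \<le> 1" by (simp add: power_mult_distrib mult.assoc)
      then show ?thesis using c(1) by (simp add: le_divide_eq)
    qed
    moreover have "1 < \<rho> * x" using z B0 by (simp add: x_def)
    ultimately show False using real_arch_pow[of "\<rho> * x" "1 / c"] by (meson not_le)
  qed
  ultimately show ?thesis using \<rho>(1) by simp
qed

lemma Q_0_1: "Q 0 0 1 = 0" "Q (Suc k) 0 1 = 1 / hsum_ratio k"
  by (simp_all add: Q_def hsum_ratio_def)

end

section \<open>Laws and harmonic functions\<close>

text \<open>A path amounts to a multiset of columns, one for each tail edge, hence to a monomial;
  formally both sides obey the same first-step recursion.\<close>

lemma path_sum_eq_d: "path_sum (b_weight b) (h, t) (H, T) = d h t H T"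
proof (induction "(Suc H - h) + (Suc T - t)" arbitrary: h t rule: less_induct)
  case less
  show ?case
  proof (cases "h \<le> H \<and> t \<le> T")
    case False
    then show ?thesis by (auto simp: path_sum_eq_0 d_def)
  next
    case True
    have IH: "path_sum (b_weight b) (Suc h, t) (H, T) = d (Suc h) t H T"
      "path_sum (b_weight b) (h, Suc t) (H, T) = d h (Suc t) H T"
      using True by (auto intro!: less)
    have "path_sum (b_weight b) (h, t) (H, T) =
        (if (h, t) = (H, T) then 1 else 0) + d (Suc h) t H T + b h * d h (Suc t) H T"
      by (subst path_sum_rec) (simp add: IH b_weight_def)
    then show ?thesis by (subst d_rec) (auto simp: d_def)
  qed
qed

lemma path_sum_pos: "path_sum (b_weight b) (0, 0) (h, t) > 0"
  by (simp add: path_sum_eq_d d_pos)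

lemma path_weight_pos: "path_weight (b_weight b) p > 0"
  by (induction p rule: induct_list012) (auto simp: b_weight_def b_pos)

text \<open>The Markov chain is driven by independent uniform variables: at \<open>x\<close> it
  moves by a head if the current variable is below \<open>c x\<close>.\<close>

lemma exists_law:
  assumes har: "harmonic \<phi>" and norm: "\<phi> 0 0 = 1"
  shows "\<exists>P\<in>laws (b_weight b). \<forall>h t. prob_fun (b_weight b) P h t = \<phi> h t"
proof -
  define \<nu> where "\<nu> = uniform_measure lborel {0..1::real}"
  have sets_\<nu>: "sets \<nu> = sets borel" and space_\<nu>: "space \<nu> = UNIV"
    by (simp_all add: \<nu>_def)
  interpret \<nu>: prob_space \<nu>
    unfolding \<nu>_def by (intro prob_space_uniform_measure) auto
  have \<nu>_less: "measure \<nu> {..<c} = c" if "0 \<le> c" "c \<le> 1" for c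
  proof -
    have "{0..1} \<inter> {..<c} = {0..<c}" using that by auto
    then have "emeasure \<nu> {..<c} = ennreal c"
      using that by (simp add: \<nu>_def divide_ennreal_def)
    then show ?thesis using that by (simp add: measure_def)
  qed
  interpret product_prob_space "\<lambda>_::nat. \<nu>" UNIV
    by unfold_locales
  define M where "M = (\<Pi>\<^sub>M i\<in>(UNIV :: nat set). \<nu>)"
  \<comment> \<open>Where \<open>\<phi>\<close> vanishes the quotient is 0 by convention; the
    relation \<open>J\<close> below survives because both of its sides are then 0.\<close>
  define c where "c x = \<phi> (Suc (fst x)) (snd x) / \<phi> (fst x) (snd x)" for x
  have c: "0 \<le> c x" "c x \<le> 1" for x
    using harmonic_nonneg[OF har] harmonic_Suc_le(1)[OF har, of "fst x" "snd x"]
    by (auto simp: c_def divide_le_eq_1 less_le)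
  define step where "step x u = (if u < c x then (Suc (fst x), snd x) else (fst x, Suc (snd x)))"
    for x and u :: real
  define J where "J x y = {u. step x u = y}" for x y
  have J_sets: "J x y \<in> sets \<nu>" for x y
  proof -
    have "{u \<in> space borel. step x u = y} \<in> sets borel"
      unfolding step_def by measurable
    then show ?thesis by (simp add: J_def sets_\<nu>)
  qed
  have J: "measure \<nu> (J x y) * \<phi> (fst x) (snd x) = b_weight b x y * \<phi> (fst y) (snd y)"
    if "is_edge x y" for x y
  proof (cases "\<phi> (fst x) (snd x) = 0")
    case True
    have "b_weight b x y * \<phi> (fst y) (snd y) \<le> \<phi> (fst x) (snd x)"
      using that harmonic_Suc_le[OF har, of "fst x" "snd x"] by (auto simp: is_edge_def b_weight_def)
    moreover have "0 \<le> b_weight b x y * \<phi> (fst y) (snd y)"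
      using harmonic_nonneg[OF har] b_nonneg by (auto simp: b_weight_def)
    ultimately show ?thesis using True by simp
  next
    case False
    from that consider "y = (Suc (fst x), snd x)" | "y = (fst x, Suc (snd x))"
      by (auto simp: is_edge_def)
    then show ?thesis
    proof cases
      case 1
      then have "J x y = {..<c x}" by (auto simp: J_def step_def)
      then show ?thesis using 1 False by (simp add: \<nu>_less c) (simp add: c_def b_weight_def)
    next
      case 2
      then have "J x y = UNIV - {..<c x}" by (auto simp: J_def step_def)
      then have "measure \<nu> (J x y) = 1 - c x"
        using \<nu>.prob_compl[of "{..<c x}"] by (simp add: space_\<nu> sets_\<nu> \<nu>_less c)
      then have "measure \<nu> (J x y) * \<phi> (fst x) (snd x) = \<phi> (fst x) (snd x) - \<phi> (Suc (fst x)) (snd x)"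
        using False by (simp only: left_diff_distrib) (simp add: c_def)
      also have "\<dots> = b (fst x) * \<phi> (fst x) (Suc (snd x))"
        using harmonic_eq[OF har, of "fst x" "snd x"] by simp
      finally show ?thesis by (simp add: 2 b_weight_def)
    qed
  qed
  define X where "X U n = rec_nat (0, 0) (\<lambda>n x. step x (U n)) n" for U :: "nat \<Rightarrow> real" and n
  have X_0: "X U 0 = (0, 0)" and X_Suc: "X U (Suc n) = step (X U n) (U n)" for U n
    by (simp_all add: X_def)
  have X_n: "(\<lambda>U. X U n) \<in> M \<rightarrow>\<^sub>M count_space UNIV" for n
  proof (induction n)
    case (Suc n)
    have U: "(\<lambda>U. U n) \<in> borel_measurable M"
      using measurable_component_singleton[of n UNIV "\<lambda>_. \<nu>"]
      by (simp add: M_def measurable_cong_sets[OF refl sets_\<nu>])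
    have "(\<lambda>U. step x (U n)) \<in> M \<rightarrow>\<^sub>M count_space UNIV" for x
      unfolding step_def using U by measurable
    then show ?case unfolding X_Suc
      by (rule measurable_compose_countable[OF _ Suc])
  qed (simp add: X_0)
  have X: "X \<in> M \<rightarrow>\<^sub>M path_space"
    unfolding path_space_def using X_n by (intro measurable_PiM_single'[of UNIV "\<lambda>n U. X U n"]) auto
  have standard: "standard_path (X U)" for U
    by (auto simp: standard_path_def X_0 X_Suc step_def is_edge_def)
  define P where "P = distr M path_space X"
  have M_prob: "prob_space M" unfolding M_def by unfold_locales
  interpret L: path_law P
  proof (intro path_law.intro path_law_axioms.intro)
    show "prob_space P" unfolding P_def by (rule prob_space.prob_space_distr[OF M_prob X])
    show "sets P = sets path_space" by (simp add: P_def)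
    have "AE U in M. standard_path (X U)" using standard by simp
    moreover have "{S. standard_path S} \<in> sets path_space"
    proof -
      have eq: "{S. standard_path S} = {S. S 0 \<in> {(0, 0)}} \<inter> (\<Inter>n. \<Union>x. {S. S n \<in> {x}} \<inter> {S. S (Suc n) \<in> {y. is_edge x y}})"
        by (auto simp: standard_path_def)
      have "{S. S n \<in> {x}} \<inter> {S. S (Suc n) \<in> {y. is_edge x y}} \<in> sets path_space" for n x
        by (rule sets.Int[OF sets_vertex sets_vertex])
      then have "(\<Union>x. {S. S n \<in> {x}} \<inter> {S. S (Suc n) \<in> {y. is_edge x y}}) \<in> sets path_space" for n
        by (rule sets.countable_UN''[OF countableI_type])
      then show ?thesis unfolding eq
        by (intro sets.Int[OF sets_vertex] sets.countable_INT) auto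
    qed
    ultimately show "AE S in P. standard_path S"
      unfolding P_def by (subst AE_distr_iff[OF X]) auto
  qed
  have "L.prob (cyl p) = path_weight (b_weight b) p * \<phi> (fst (last p)) (snd (last p))" if "std p" for p
  proof -
    have ne: "p \<noteq> []" and hd: "hd p = (0, 0)" using that by (auto simp: std_def)
    have 1: "X -` cyl p \<inter> space M = {U \<in> space M. \<forall>i\<in>{..<length p - 1}. U i \<in> J (p ! i) (p ! Suc i)}"
    proof -
      have "X U \<in> cyl p \<longleftrightarrow> (\<forall>i<length p - 1. U i \<in> J (p ! i) (p ! Suc i))" for U
      proof
        assume "X U \<in> cyl p"
        then have "X U i = p ! i" if "i < length p" for i using that by (simp add: cyl_def)
        then have "step (p ! i) (U i) = p ! Suc i" if "i < length p - 1" for i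
          using X_Suc[of U i] that by simp
        then show "\<forall>i<length p - 1. U i \<in> J (p ! i) (p ! Suc i)" by (simp add: J_def)
      next
        assume U: "\<forall>i<length p - 1. U i \<in> J (p ! i) (p ! Suc i)"
        have "X U i = p ! i" if "i < length p" for i
          using that
        proof (induction i)
          case 0
          then show ?case using hd ne by (simp add: X_0 hd_conv_nth)
        next
          case (Suc i)
          have "i < length p - 1" using Suc.prems by simp
          then show ?case using Suc U by (simp add: X_Suc J_def)
        qed
        then show "X U \<in> cyl p" by (simp add: cyl_def)
      qed
      then show ?thesis by auto
    qed
    have "L.prob (cyl p) = measure M (X -` cyl p \<inter> space M)"
      unfolding P_def by (rule measure_distr[OF X sets_cyl])
    also have "\<dots> = (\<Prod>i<length p - 1. measure \<nu> (J (p ! i) (p ! Suc i)))"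
    proof -
      have "emeasure M (X -` cyl p \<inter> space M) = (\<Prod>i<length p - 1. emeasure \<nu> (J (p ! i) (p ! Suc i)))"
        unfolding 1 unfolding M_def by (intro emeasure_PiM_Collect) (auto simp: J_sets)
      also have "\<dots> = ennreal (\<Prod>i<length p - 1. measure \<nu> (J (p ! i) (p ! Suc i)))"
        by (simp add: \<nu>.emeasure_eq_measure prod_ennreal)
      finally show ?thesis by (simp add: measure_def prod_nonneg)
    qed
    \<comment> \<open>Each transition contributes its edge weight and a quotient of values of
      \<open>\<phi>\<close>, so the product telescopes. Relation \<open>J\<close> expresses this
      without division, since \<open>\<phi>\<close> may have zeros.\<close>
    also have "\<dots> = path_weight (b_weight b) p * \<phi> (fst (last p)) (snd (last p))"
      using that
    proof (induction p rule: rev_induct)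
      case (snoc z p)
      show ?case
      proof (cases "p = []")
        case True
        then show ?thesis using snoc.prems norm by (simp add: std_def)
      next
        case False
        then have p: "std p" "is_edge (last p) z"
          using snoc.prems by (auto simp: std_def successively_append_iff)
        obtain n where n: "length p = Suc n" using False by (cases p) auto
        have "(\<Prod>i<length (p @ [z]) - 1. measure \<nu> (J ((p @ [z]) ! i) ((p @ [z]) ! Suc i)))
            = (\<Prod>i<n. measure \<nu> (J (p ! i) (p ! Suc i))) * measure \<nu> (J (last p) z)"
          using False by (simp add: n nth_append last_conv_nth)
        also have "\<dots> = path_weight (b_weight b) p * (measure \<nu> (J (last p) z) * \<phi> (fst (last p)) (snd (last p)))"
          using snoc.IH[OF p(1)] by (simp add: n)
        also have "\<dots> = path_weight (b_weight b) p * (b_weight b (last p) z * \<phi> (fst z) (snd z))"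
          by (simp only: J[OF p(2)])
        finally show ?thesis by (simp add: path_weight_snoc[OF False])
      qed
    qed (simp add: std_def)
    finally show ?thesis .
  qed
  from L.laws_of_cyl[OF this path_sum_pos] show ?thesis by blast
qed

lemma prob_fun_unique:
  assumes P: "P \<in> laws (b_weight b)" and P': "P' \<in> laws (b_weight b)"
    and eq: "\<And>h t. prob_fun (b_weight b) P h t = prob_fun (b_weight b) P' h t"
  shows "P = P'"
proof -
  interpret P: path_law P using P by (rule path_law_laws)
  interpret P': path_law P' using P' by (rule path_law_laws)
  show ?thesis
  proof (rule law_eqI[OF P.prob_space_axioms P.sets_P P'.prob_space_axioms P'.sets_P])
    fix p
    consider "p = []" | "p \<noteq> []" "\<not> std p" | "std p" by blast
    then show "P.prob (cyl p) = P'.prob (cyl p)"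
    proof cases
      case 1
      then show ?thesis using P.prob_space P'.prob_space by (simp add: cyl_def)
    next
      case 2
      then show ?thesis by (simp add: P.prob_not_std P'.prob_not_std)
    next
      case 3
      then show ?thesis by (simp add: cyl_of_law[OF P _ path_sum_pos] cyl_of_law[OF P' _ path_sum_pos] eq)
    qed
  qed
qed

lemma ex1_law:
  assumes "harmonic \<phi>" "\<phi> 0 0 = 1"
  shows "\<exists>!P. has_prob_fun (b_weight b) \<phi> P"
  using exists_law[OF assms] prob_fun_unique unfolding has_prob_fun_def by (metis (no_types, lifting))

text \<open>A single standard path to \<open>(h, t)\<close> suffices: its cylinder splits almost
  surely into those of its two extensions, and its positive weight cancels.\<close>

lemma harmonic_prob_fun:
  assumes P: "P \<in> laws (b_weight b)"
  shows "harmonic (prob_fun (b_weight b) P)" "prob_fun (b_weight b) P 0 0 = 1"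
proof -
  interpret path_law P using P by (rule path_law_laws)
  let ?\<phi> = "prob_fun (b_weight b) P"
  note cyl = cyl_of_law[OF P _ path_sum_pos]
  have "prob (cyl [(0, 0)]) = prob (cyl [])"
  proof (rule finite_measure_eq_AE)
    show "AE S in P. S \<in> cyl [(0, 0)] \<longleftrightarrow> S \<in> cyl []"
      using AE_standard by eventually_elim (simp add: cyl_def standard_path_def)
  qed (simp_all add: sets_P sets_cyl)
  then show "?\<phi> 0 0 = 1"
    using cyl[of "[(0, 0)]"] prob_space by (simp add: std_def cyl_def)
  show "harmonic ?\<phi>"
    unfolding harmonic_def
  proof (intro conjI allI)
    fix h t
    show "0 \<le> ?\<phi> h t"
      using path_sum_pos[of h t] by (simp add: prob_fun_def)
    have "paths (0, 0) (h, t) \<noteq> {}"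
      using path_sum_pos[of h t] by (auto simp: path_sum_def)
    then obtain p where p: "std p" "last p = (h, t)" by (auto simp: paths_def std_def)
    have len: "length p = Suc (h + t)" using length_std[OF p(1)] p(2) by simp
    have ne: "p \<noteq> []" using p by (simp add: std_def)
    let ?p1 = "p @ [(Suc h, t)]" and ?p2 = "p @ [(h, Suc t)]"
    have "prob (cyl p) = prob (cyl ?p1 \<union> cyl ?p2)"
    proof (rule finite_measure_eq_AE)
      show "AE S in P. S \<in> cyl p \<longleftrightarrow> S \<in> cyl ?p1 \<union> cyl ?p2"
        using AE_standard
      proof eventually_elim
        case (elim S)
        have "S (length p) = (Suc h, t) \<or> S (length p) = (h, Suc t)" if "S \<in> cyl p"
        proof -
          have "S (h + t) = (h, t)" using that p(2) ne by (simp add: cyl_def len last_conv_nth)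
          then show ?thesis using elim by (auto simp: standard_path_def len is_edge_def dest: spec[of _ "h + t"])
        qed
        then show ?case by (auto simp: cyl_snoc)
      qed
    qed (auto simp: sets_P intro!: sets.Un sets_cyl)
    also have "\<dots> = prob (cyl ?p1) + prob (cyl ?p2)"
      by (rule finite_measure_Union) (simp_all add: sets_P sets_cyl, auto simp: cyl_snoc)
    finally have "path_weight (b_weight b) p * ?\<phi> h t =
        path_weight (b_weight b) p * (?\<phi> (Suc h) t + b h * ?\<phi> h (Suc t))"
      using cyl[of p] cyl[of ?p1] cyl[of ?p2] p ne
      by (simp add: std_snoc is_edge_def path_weight_snoc b_weight_def algebra_simps)
    then show "?\<phi> h t = ?\<phi> (Suc h) t + b h * ?\<phi> h (Suc t)"
      using path_weight_pos[of p] by simp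
  qed
qed

lemma first_head_eq:
  assumes P: "P \<in> laws (b_weight b)"
  shows "first_head P = 1 - b 0 * prob_fun (b_weight b) P 0 1"
proof -
  interpret path_law P using P by (rule path_law_laws)
  have "first_head P = prob (cyl [(0, 0), (1, 0)])"
    unfolding first_head_def
  proof (rule finite_measure_eq_AE)
    show "AE S in P. S \<in> {S \<in> space P. fst (S 1) = 1} \<longleftrightarrow> S \<in> cyl [(0, 0), (1, 0)]"
      using AE_standard
    proof eventually_elim
      case (elim S)
      then have "S 0 = (0, 0)" "is_edge (S 0) (S (Suc 0))" unfolding standard_path_def by blast+
      then show ?case by (auto simp: cyl_def is_edge_def less_Suc_eq)
    qed
    have "{S. S 1 \<in> {x. fst x = 1}} \<in> sets path_space" by (rule sets_vertex)
    then show "{S \<in> space P. fst (S 1) = 1} \<in> events" by (simp add: sets_P)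
  qed (simp add: sets_P sets_cyl)
  also have "\<dots> = prob_fun (b_weight b) P 1 0"
    using cyl_of_law[OF P _ path_sum_pos, of "[(0, 0), (1, 0)]"]
    by (simp add: std_def is_edge_def b_weight_def)
  also have "\<dots> = 1 - b 0 * prob_fun (b_weight b) P 0 1"
    using harmonic_eq[OF harmonic_prob_fun(1)[OF P], of 0 0] harmonic_prob_fun(2)[OF P] by simp
  finally show ?thesis .
qed

section \<open>Extreme laws and minimal harmonic functions\<close>

lemma prob_fun_mixture:
  assumes "\<And>A. A \<in> sets path_space \<Longrightarrow> measure P A = u * measure P1 A + v * measure P2 A"
    and "space P = UNIV" "space P1 = UNIV" "space P2 = UNIV"
  shows "prob_fun w P h t = u * prob_fun w P1 h t + v * prob_fun w P2 h t"
  using assms(1)[OF sets_vertex[of "h + t" "{(h, t)}"]] assms(2-)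
  by (simp add: prob_fun_def add_divide_distrib)

text \<open>A component of a mixture is dominated by a multiple of the whole, so minimality makes it
  equal to the whole. Conversely a minorant, normalized, and the normalized remainder are components
  of a mixture, and extremality makes them equal.\<close>

lemma extreme_laws_iff:
  assumes P: "P \<in> laws (b_weight b)"
  shows "P \<in> extreme_laws (b_weight b) \<longleftrightarrow> minimal (prob_fun (b_weight b) P)"
proof -
  let ?w = "b_weight b"
  let ?\<phi> = "prob_fun ?w P"
  interpret P: path_law P using P by (rule path_law_laws)
  note har = harmonic_prob_fun[OF P]
  show ?thesis
  proof
    assume min: "minimal ?\<phi>"
    have "P1 = P2" if P1: "P1 \<in> laws ?w" and P2: "P2 \<in> laws ?w" and u: "0 < u" "u < 1"
      and mix: "\<forall>A\<in>sets path_space. measure P A = u * measure P1 A + (1 - u) * measure P2 A" for P1 P2 u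
    proof -
      interpret P1: path_law P1 using P1 by (rule path_law_laws)
      interpret P2: path_law P2 using P2 by (rule path_law_laws)
      have eq: "?\<phi> h t = u * prob_fun ?w P1 h t + (1 - u) * prob_fun ?w P2 h t" for h t
        using mix by (intro prob_fun_mixture) auto
      have nn: "0 \<le> prob_fun ?w P1 h t" "0 \<le> prob_fun ?w P2 h t" for h t
        using harmonic_nonneg harmonic_prob_fun(1) P1 P2 by blast+
      have "0 \<le> u * prob_fun ?w P1 h t" "0 \<le> (1 - u) * prob_fun ?w P2 h t" for h t
        using nn u by simp_all
      then have le: "u * prob_fun ?w P1 h t \<le> ?\<phi> h t" "(1 - u) * prob_fun ?w P2 h t \<le> ?\<phi> h t" for h t
        unfolding eq by simp_all
      have "prob_fun ?w P1 h t \<le> (1 / u) * ?\<phi> h t" for h t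
        using u le(1)[of h t] by (simp add: le_divide_eq mult.commute)
      from minimalD(3)[OF min harmonic_prob_fun(1)[OF P1] this]
      have 1: "prob_fun ?w P1 h t = ?\<phi> h t" for h t using harmonic_prob_fun(2)[OF P1] by simp
      have "prob_fun ?w P2 h t \<le> (1 / (1 - u)) * ?\<phi> h t" for h t
        using u le(2)[of h t] by (simp add: le_divide_eq mult.commute)
      from minimalD(3)[OF min harmonic_prob_fun(1)[OF P2] this]
      have 2: "prob_fun ?w P2 h t = ?\<phi> h t" for h t using harmonic_prob_fun(2)[OF P2] by simp
      show ?thesis by (rule prob_fun_unique[OF P1 P2]) (simp add: 1 2)
    qed
    then show "P \<in> extreme_laws ?w" using P unfolding extreme_laws_def by blast
  next
    assume ext: "P \<in> extreme_laws ?w"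
    show "minimal ?\<phi>"
      unfolding minimal_def
    proof (intro conjI allI impI har)
      fix \<psi> C h t
      assume \<psi>: "harmonic \<psi>" and "\<forall>h t. \<psi> h t \<le> C * ?\<phi> h t"
      then have le: "\<psi> h t \<le> C * ?\<phi> h t" for h t by blast
      show "\<psi> h t = \<psi> 0 0 * ?\<phi> h t"
      proof (cases "\<psi> 0 0 = 0")
        case True
        then show ?thesis using harmonic_zero[OF \<psi>] by simp
      next
        case False
        then have p0: "\<psi> 0 0 > 0" using harmonic_nonneg[OF \<psi>, of 0 0] by simp
        have C: "\<psi> 0 0 \<le> C" using le[of 0 0] har(2) by simp
        \<comment> \<open>Dividing by \<open>C + 1\<close> instead of \<open>C\<close> ensures
          \<open>u < 1\<close>, so that a remainder is left.\<close>
        define u where "u = \<psi> 0 0 / (C + 1)"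
        have u: "0 < u" "u < 1" using p0 C by (auto simp: u_def)
        \<comment> \<open>The zero summand fits the shape of
          \<open>harmonic_lincomb\<close>.\<close>
        define \<phi>1 where "\<phi>1 h t = (1 / \<psi> 0 0) * \<psi> h t + 0 * \<psi> h t" for h t
        define \<phi>2 where "\<phi>2 h t = (1 / (1 - u)) * ?\<phi> h t + (- (1 / ((C + 1) * (1 - u)))) * \<psi> h t" for h t
        have h1: "harmonic \<phi>1" unfolding \<phi>1_def
          using p0 harmonic_nonneg[OF \<psi>] by (intro harmonic_lincomb \<psi>) auto
        have h2: "harmonic \<phi>2" unfolding \<phi>2_def
        proof (intro harmonic_lincomb har \<psi>)
          fix h t
          have "\<psi> h t \<le> (C + 1) * ?\<phi> h t"
            using le[of h t] harmonic_nonneg[OF har(1), of h t] by (simp add: algebra_simps)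
          then have "\<psi> h t / (C + 1) \<le> ?\<phi> h t" using p0 C by (simp add: divide_le_eq mult.commute)
          then have "0 \<le> 1 / (1 - u) * (?\<phi> h t - \<psi> h t / (C + 1))" using u by simp
          then show "0 \<le> 1 / (1 - u) * ?\<phi> h t + - (1 / ((C + 1) * (1 - u))) * \<psi> h t"
            by (simp add: right_diff_distrib mult.commute)
        qed
        have mix: "?\<phi> h t = u * \<phi>1 h t + (1 - u) * \<phi>2 h t" for h t
        proof -
          have "u * \<phi>1 h t = \<psi> h t / (C + 1)" using p0 by (simp add: \<phi>1_def u_def)
          moreover have "(1 - u) * \<phi>2 h t = ?\<phi> h t - \<psi> h t / (C + 1)"
          proof -
            have "v * (1 / v * a + - (1 / (c * v)) * p) = a - p / c" if "v \<noteq> 0" for a c p v :: real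
              using that by (simp add: right_diff_distrib)
            then show ?thesis using u unfolding \<phi>2_def by simp
          qed
          ultimately show ?thesis by simp
        qed
        have n1: "\<phi>1 0 0 = 1" using p0 by (simp add: \<phi>1_def)
        have n2: "\<phi>2 0 0 = 1" 
        proof -
          have "(1 - u) * \<phi>2 0 0 = 1 - u" using mix[of 0 0] unfolding n1 har(2) by linarith
          then show ?thesis using u by (metis diff_gt_0_iff_gt less_irrefl mult_cancel_left1)
        qed
        obtain P1 where P1: "P1 \<in> laws ?w" "\<And>h t. prob_fun ?w P1 h t = \<phi>1 h t"
          using exists_law[OF h1 n1] by blast
        obtain P2 where P2: "P2 \<in> laws ?w" "\<And>h t. prob_fun ?w P2 h t = \<phi>2 h t"
          using exists_law[OF h2 n2] by blast
        interpret P1: path_law P1 using P1(1) by (rule path_law_laws)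
        interpret P2: path_law P2 using P2(1) by (rule path_law_laws)
        have "P.prob (cyl p) = u * P1.prob (cyl p) + (1 - u) * P2.prob (cyl p)" for p
        proof -
          consider "p = []" | "p \<noteq> []" "\<not> std p" | "std p" by blast
          then show ?thesis
          proof cases
            case 1
            then show ?thesis using P.prob_space P1.prob_space P2.prob_space by (simp add: cyl_def)
          next
            case 2
            then show ?thesis by (simp add: P.prob_not_std P1.prob_not_std P2.prob_not_std)
          next
            case 3
            note c = cyl_of_law[OF _ 3 path_sum_pos]
            show ?thesis unfolding c[OF P] c[OF P1(1)] c[OF P2(1)] P1(2) P2(2)
              by (subst mix) (simp add: algebra_simps)
          qed
        qed
        then have "measure P A = u * measure P1 A + (1 - u) * measure P2 A" if "A \<in> sets path_space" for A
          using measure_eq_mixture[OF P.prob_space_axioms P.sets_P P1.prob_space_axioms P1.sets_P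
            P2.prob_space_axioms P2.sets_P _ that] by blast
        then have "P1 = P2" using ext P1(1) P2(1) u unfolding extreme_laws_def by blast
        then have "\<phi>2 h t = \<phi>1 h t" using P1(2) P2(2) by simp
        then have "?\<phi> h t = \<phi>1 h t" using mix[of h t] by (simp add: algebra_simps)
        then show ?thesis using p0 by (simp add: \<phi>1_def)
      qed
    qed
  qed
qed

lemma extreme_laws_eq: "extreme_laws (b_weight b) = {P. \<exists>\<phi>. minimal \<phi> \<and> has_prob_fun (b_weight b) \<phi> P}"
proof (intro equalityI subsetI CollectI)
  fix P assume "P \<in> extreme_laws (b_weight b)"
  moreover then have "P \<in> laws (b_weight b)" by (simp add: extreme_laws_def)
  ultimately show "\<exists>\<phi>. minimal \<phi> \<and> has_prob_fun (b_weight b) \<phi> P"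
    using extreme_laws_iff by (auto simp: has_prob_fun_def)
next
  fix P assume "P \<in> {P. \<exists>\<phi>. minimal \<phi> \<and> has_prob_fun (b_weight b) \<phi> P}"
  then obtain \<phi> where \<phi>: "minimal \<phi>" "P \<in> laws (b_weight b)" "prob_fun (b_weight b) P = \<phi>"
    by (auto simp: has_prob_fun_def fun_eq_iff)
  then show "P \<in> extreme_laws (b_weight b)" using extreme_laws_iff by simp
qed

section \<open>Probability functions of the special laws\<close>

lemma phi_theta_eq_kern: "\<theta> \<noteq> 0 \<Longrightarrow> phi_theta b \<theta> h t = kern (1 / \<theta>) h t"
proof -
  assume \<theta>: "\<theta> \<noteq> 0"
  have "(\<Prod>j<h. 1 - b j * (1 / \<theta>)) = (\<Prod>j<h. (\<theta> - b j) / \<theta>)"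
    using \<theta> by (intro prod.cong) (auto simp: field_simps)
  then show ?thesis using \<theta> unfolding phi_theta_def kern_def
    by (simp add: prod_dividef power_add power_divide)
qed

lemma phi_inf_eq_kern: "phi_inf h t = kern 0 h t"
  by (simp add: phi_inf_def kern_def)

lemma path_sum_ratio: "path_sum (b_weight b) (h, t) (H, T) / path_sum (b_weight b) (0, 0) (H, T) = martin h t H T"
  by (simp add: path_sum_eq_d martin_def)

lemma has_prob_fun_cong:
  "(\<And>h t. \<phi> h t = \<psi> h t) \<Longrightarrow> has_prob_fun w \<phi> P \<longleftrightarrow> has_prob_fun w \<psi> P"
  by (simp add: has_prob_fun_def)

text \<open>Limits are unique, and the limit of the Martin kernels has the prescribed support, so
  the definition reduces to a condition on the probability function.\<close>

lemma is_Q_left_iff: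
  assumes "\<And>j. j < m \<Longrightarrow> b j < b m"
  shows "is_Q_left (b_weight b) m P \<longleftrightarrow> has_prob_fun (b_weight b) (kern (1 / b m)) P"
proof -
  have lim: "(\<lambda>n. martin h t m (n - m)) \<longlonglongrightarrow> kern (1 / b m) h t" for h t
    by (rule filterlim_compose[OF martin_tendsto_record[OF assms] filterlim_minus_const_nat_at_top])
  show ?thesis
  proof
    assume "is_Q_left (b_weight b) m P"
    then show "has_prob_fun (b_weight b) (kern (1 / b m)) P"
      unfolding is_Q_left_def has_prob_fun_def path_sum_ratio using LIMSEQ_unique[OF _ lim] by blast
  next
    assume "has_prob_fun (b_weight b) (kern (1 / b m)) P"
    then have P: "P \<in> laws (b_weight b)" and eq: "\<And>h t. prob_fun (b_weight b) P h t = kern (1 / b m) h t"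
      by (auto simp: has_prob_fun_def)
    show "is_Q_left (b_weight b) m P"
      unfolding is_Q_left_def path_sum_ratio eq
      using P lim kern_record_pos[OF assms] kern_record_zero[OF assms] by (simp add: not_le)
  qed
qed

lemma is_Q_right_iff:
  assumes "summable b"
  shows "is_Q_right (b_weight b) m P \<longleftrightarrow> has_prob_fun (b_weight b) (Q m) P"
proof -
  have lim: "(\<lambda>n. martin h t (n - m) m) \<longlonglongrightarrow> Q m h t" for h t
    by (rule filterlim_compose[OF martin_tendsto_Q[OF assms] filterlim_minus_const_nat_at_top])
  show ?thesis
  proof
    assume "is_Q_right (b_weight b) m P"
    then show "has_prob_fun (b_weight b) (Q m) P"
      unfolding is_Q_right_def has_prob_fun_def path_sum_ratio using LIMSEQ_unique[OF _ lim] by blast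
  next
    assume "has_prob_fun (b_weight b) (Q m) P"
    then have P: "P \<in> laws (b_weight b)" and eq: "\<And>h t. prob_fun (b_weight b) P h t = Q m h t"
      by (auto simp: has_prob_fun_def)
    show "is_Q_right (b_weight b) m P"
      unfolding is_Q_right_def path_sum_ratio eq
      using P lim Q_pos[OF assms] Q_zero[OF assms] by (simp add: not_le)
  qed
qed

lemma ex1_Q_left:
  "(\<And>j. j < m \<Longrightarrow> b j < b m) \<Longrightarrow> \<exists>!P. is_Q_left (b_weight b) m P"
  using ex1_law[OF harmonic_kern_record, of m] by (simp add: is_Q_left_iff)

lemma ex1_Q_right: "summable b \<Longrightarrow> \<exists>!P. is_Q_right (b_weight b) m P"
  using ex1_law[OF harmonic_Q Q_0_0] by (simp add: is_Q_right_iff)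

lemma Q_left_law:
  "(\<And>j. j < m \<Longrightarrow> b j < b m) \<Longrightarrow> has_prob_fun (b_weight b) (kern (1 / b m)) (Q_left (b_weight b) m)"
  using theI'[OF ex1_Q_left[of m]] by (simp add: is_Q_left_iff Q_left_def)

lemma Q_right_law: "summable b \<Longrightarrow> has_prob_fun (b_weight b) (Q m) (Q_right (b_weight b) m)"
  using theI'[OF ex1_Q_right[of m]] by (simp add: is_Q_right_iff Q_right_def)

lemma ex1_theta:
  assumes "\<theta> > 0" "\<And>j. b j \<le> \<theta>"
  shows "\<exists>!P. has_prob_fun (b_weight b) (phi_theta b \<theta>) P"
proof -
  have "harmonic (kern (1 / \<theta>))" using assms by (intro harmonic_kern_le) auto
  then show ?thesis
    using ex1_law[of "kern (1 / \<theta>)"] assms(1)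
    by (simp add: has_prob_fun_cong[of "phi_theta b \<theta>" "kern (1 / \<theta>)"] phi_theta_eq_kern)
qed

lemma P_theta_law:
  assumes "\<theta> > 0" "\<And>j. b j \<le> \<theta>"
  shows "has_prob_fun (b_weight b) (kern (1 / \<theta>)) (P_theta b \<theta>)"
  using theI'[OF ex1_theta[OF assms]] assms(1)
  by (simp add: P_theta_def has_prob_fun_cong[of "phi_theta b \<theta>" "kern (1 / \<theta>)"] phi_theta_eq_kern)

lemma ex1_inf: "\<exists>!P. has_prob_fun (b_weight b) phi_inf P"
proof -
  have "harmonic (kern 0)" by (intro harmonic_kern_le) auto
  then show ?thesis
    using ex1_law[of "kern 0"]
    by (simp add: has_prob_fun_cong[of phi_inf "kern 0"] phi_inf_eq_kern)
qed

lemma P_inf_law: "has_prob_fun (b_weight b) (kern 0) (P_inf b)"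
  using theI'[OF ex1_inf]
  by (simp add: P_inf_def has_prob_fun_cong[of phi_inf "kern 0"] phi_inf_eq_kern)

lemma has_prob_fun_unique:
  "has_prob_fun (b_weight b) \<phi> P \<Longrightarrow> has_prob_fun (b_weight b) \<phi> P' \<Longrightarrow> P = P'"
  by (rule prob_fun_unique) (auto simp: has_prob_fun_def)

lemma first_head_law:
  "has_prob_fun (b_weight b) \<phi> P \<Longrightarrow> first_head P = 1 - b 0 * \<phi> 0 1"
  by (simp add: has_prob_fun_def first_head_eq)

section \<open>Determination of the extreme laws\<close>

lemma extreme_summable:
  assumes sm: "summable b"
  shows "extreme_laws (b_weight b) =
    {Q_left (b_weight b) m | m. \<forall>j<m. b m > b j} \<union> {Q_right (b_weight b) m | m. True}" (is "?L = ?R")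
proof (intro equalityI subsetI)
  fix P assume "P \<in> ?L"
  then obtain \<phi> where \<phi>: "minimal \<phi>" "has_prob_fun (b_weight b) \<phi> P"
    by (auto simp: extreme_laws_eq)
  from minimal_summable_cases[OF sm \<phi>(1)] show "P \<in> ?R"
  proof cases
    case (1 m)
    then have "P = Q_right (b_weight b) m"
      using \<phi>(2) has_prob_fun_unique Q_right_law[OF sm] by blast
    then show ?thesis by blast
  next
    case (2 m)
    then have "P = Q_left (b_weight b) m"
      using \<phi>(2) has_prob_fun_unique Q_left_law[of m] by blast
    then show ?thesis using 2(1) by blast
  qed
next
  fix P assume "P \<in> ?R"
  then consider m where "P = Q_left (b_weight b) m" "\<forall>j<m. b m > b j" | m where "P = Q_right (b_weight b) m"
    by blast
  then show "P \<in> ?L"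
  proof cases
    case (1 m)
    then show ?thesis unfolding extreme_laws_eq
      using minimal_kern_record[of m] Q_left_law[of m] by blast
  next
    case (2 m)
    then show ?thesis unfolding extreme_laws_eq
      using minimal_Q[OF sm, of m] Q_right_law[OF sm, of m] by blast
  qed
qed

lemma extreme_not_summable:
  assumes ns: "\<not> summable b" and B: "\<And>j. b j \<le> B" "\<And>u. (\<And>j. b j \<le> u) \<Longrightarrow> B \<le> u"
  shows "extreme_laws (b_weight b) =
    {Q_left (b_weight b) m | m. \<forall>j<m. b m > b j} \<union>
      ({P_theta b \<theta> | \<theta>. \<theta> > B} \<union> {P_theta b B, P_inf b})" (is "?L = ?R")
proof (intro equalityI subsetI)
  have B0: "B > 0" using B(1)[of 0] b_pos[of 0] by linarith
  fix P assume "P \<in> ?L"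
  then obtain \<phi> where \<phi>: "minimal \<phi>" "has_prob_fun (b_weight b) \<phi> P"
    by (auto simp: extreme_laws_eq)
  have "regular \<phi>" using minimalD(1)[OF \<phi>(1)] ns by (rule regularI_not_summable)
  from minimal_regular_kern[OF \<phi>(1) this] obtain x
    where x: "x \<ge> 0" "\<phi> = kern x" "harmonic (kern x)" by blast
  from x(3) show "P \<in> ?R"
  proof (cases rule: harmonic_kern_cases)
    case 1
    show ?thesis
    proof (cases "x = 0")
      case True
      then have "P = P_inf b" using \<phi>(2) x(2) has_prob_fun_unique P_inf_law by blast
      then show ?thesis by blast
    next
      case False
      then have x0: "x > 0" using x(1) by simp
      define \<theta> where "\<theta> = 1 / x"
      have \<theta>: "\<theta> > 0" "x = 1 / \<theta>" using x0 by (simp_all add: \<theta>_def)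
      have le: "b j \<le> \<theta>" for j using 1[of j] x0 by (simp add: \<theta>_def field_simps less_imp_le)
      have "P = P_theta b \<theta>"
        using \<phi>(2) has_prob_fun_unique P_theta_law[OF \<theta>(1) le] unfolding x(2) \<theta>(2) by blast
      moreover have "\<theta> = B \<or> \<theta> > B" using B(2)[OF le] by auto
      ultimately show ?thesis by blast
    qed
  next
    case (2 m)
    then have "P = Q_left (b_weight b) m"
      using \<phi>(2) x(2) has_prob_fun_unique Q_left_law[of m] by blast
    then show ?thesis using 2(1) by blast
  qed
next
  have B0: "B > 0" using B(1)[of 0] b_pos[of 0] by linarith
  have kern: "minimal (kern x)" if "x \<ge> 0" "\<And>j. b j * x \<le> 1" for x
    using ns harmonic_kern_le[OF that] by (rule minimal_kern_not_summable)
  have \<theta>: "P_theta b \<theta> \<in> ?L" if "\<theta> \<ge> B" for \<theta>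
  proof -
    have t0: "\<theta> > 0" and le: "\<And>j. b j \<le> \<theta>" using that B(1) B0 by (auto intro: order_trans)
    have "minimal (kern (1 / \<theta>))" using t0 le by (intro kern) auto
    then show ?thesis using P_theta_law[OF t0 le] unfolding extreme_laws_eq by blast
  qed
  have inf: "P_inf b \<in> ?L" unfolding extreme_laws_eq using P_inf_law kern[of 0] by auto
  fix P assume "P \<in> ?R"
  then consider m where "P = Q_left (b_weight b) m" "\<forall>j<m. b m > b j" |
    \<theta> where "P = P_theta b \<theta>" "\<theta> \<ge> B" | "P = P_inf b"
    by (auto intro: less_imp_le)
  then show "P \<in> ?L"
  proof cases
    case (1 m)
    then show ?thesis unfolding extreme_laws_eq
      using minimal_kern_record[of m] Q_left_law[of m] by blast
  qed (use \<theta> inf in auto)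
qed

end

text \<open>Away from \<open>L\<close> only finitely many terms of the sequence remain, so nothing
  else accumulates; \<open>L\<close> does, because the terms approach it without reaching
  it.\<close>

lemma islimpt_sequence_Un_finite:
  fixes f :: "nat \<Rightarrow> real"
  assumes lim: "f \<longlonglongrightarrow> L" and ne: "\<And>n. f n \<noteq> L" and fin: "finite F"
    and E: "E \<subseteq> F \<union> range f" "range f \<subseteq> E"
  shows "x islimpt E \<longleftrightarrow> x = L"
proof
  assume "x islimpt E"
  then have "x islimpt F \<union> range f" using E(1) islimpt_subset by blast
  then have x: "x islimpt range f" using fin by (simp add: islimpt_Un islimpt_finite)
  show "x = L"
  proof (rule ccontr)
    assume "x \<noteq> L"
    then obtain U V where UV: "open U" "open V" "x \<in> U" "L \<in> V" "U \<inter> V = {}"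
      using hausdorff by metis
    obtain N where N: "\<And>n. n \<ge> N \<Longrightarrow> f n \<in> V"
      using topological_tendstoD[OF lim UV(2,4)] by (auto simp: eventually_sequentially)
    have "range f \<inter> U \<subseteq> f ` {..<N}" using N UV(5) by (force simp: not_le[symmetric])
    moreover have "infinite (range f \<inter> U)"
      using x UV(1,3) by (simp add: islimpt_eq_acc_point Int_commute)
    ultimately show False using finite_subset by blast
  qed
next
  assume "x = L"
  have "L islimpt range f"
    unfolding islimpt_sequential using ne lim by blast
  then show "x islimpt E" using E(2) islimpt_subset \<open>x = L\<close> by blast
qed

text \<open>The special laws are definite descriptions, hence the accompanying claims of unique
  existence. In the divergent case the family is closed up by \<open>\<theta> = B\<close> and by the
  law of heads only; their first-head probabilities are the two ends of the interval.\<close>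

theorem proposition10:
  fixes b :: "nat \<Rightarrow> real" and w :: edge_weight and B :: real and E :: "real set"
  assumes b_pos: "\<And>h. b h > 0"
    and b_bdd: "bdd_above (range b)"
    and B_def: "B = (SUP h. b h)"
    and w_def: "w = b_weight b"
    and E_def: "E = first_head ` extreme_laws w"
  shows "(summable b \<longrightarrow>
           (\<forall>\<theta>>B. (\<exists>!P. has_prob_fun w (phi_theta b \<theta>) P) \<and> P_theta b \<theta> \<notin> extreme_laws w) \<and>
           (\<forall>m. (\<forall>j<m. b m > b j) \<longrightarrow> (\<exists>!P. is_Q_left w m P)) \<and>
           (\<forall>m. \<exists>!P. is_Q_right w m P) \<and>
           extreme_laws w = {Q_left w m | m. \<forall>j<m. b m > b j} \<union> {Q_right w m | m. True} \<and>
           (\<forall>x\<in>E - {1 - b 0 / B}. x isolated_in E) \<and>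
           {x. x islimpt E} = {1 - b 0 / B}) \<and>
         (\<not> summable b \<longrightarrow>
           (\<forall>\<theta>\<ge>B. \<exists>!P. has_prob_fun w (phi_theta b \<theta>) P) \<and>
           (\<exists>!P. has_prob_fun w phi_inf P) \<and>
           (\<forall>m. (\<forall>j<m. b m > b j) \<longrightarrow> (\<exists>!P. is_Q_left w m P)) \<and>
           extreme_laws w = {Q_left w m | m. \<forall>j<m. b m > b j} \<union>
             ({P_theta b \<theta> | \<theta>. \<theta> > B} \<union> {P_theta b B, P_inf b}) \<and>
           {1 - b 0 / B .. 1} \<subseteq> E)"
proof -
  interpret pos_weights b by unfold_locales (rule b_pos)
  have le_B: "b j \<le> B" for j unfolding B_def using b_bdd by (intro cSUP_upper) auto
  have B_le: "B \<le> u" if "\<And>j. b j \<le> u" for u unfolding B_def using that by (intro cSUP_least) auto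
  have B0: "B > 0" using le_B[of 0] b_pos[of 0] by linarith
  have theta: "\<exists>!P. has_prob_fun w (phi_theta b \<theta>) P" if "\<theta> \<ge> B" for \<theta>
    unfolding w_def using that B0 le_B by (intro ex1_theta) (auto intro: order_trans)
  have Ql: "\<exists>!P. is_Q_left w m P" if "\<forall>j<m. b m > b j" for m
    unfolding w_def using that by (intro ex1_Q_left) blast
  have summ: "(\<forall>\<theta>>B. (\<exists>!P. has_prob_fun w (phi_theta b \<theta>) P) \<and> P_theta b \<theta> \<notin> extreme_laws w) \<and>
           (\<forall>m. (\<forall>j<m. b m > b j) \<longrightarrow> (\<exists>!P. is_Q_left w m P)) \<and>
           (\<forall>m. \<exists>!P. is_Q_right w m P) \<and>
           extreme_laws w = {Q_left w m | m. \<forall>j<m. b m > b j} \<union> {Q_right w m | m. True} \<and>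
           (\<forall>x\<in>E - {1 - b 0 / B}. x isolated_in E) \<and>
           {x. x islimpt E} = {1 - b 0 / B}" if sm: "summable b"
  proof -
    have not_ext: "P_theta b \<theta> \<notin> extreme_laws w" if "\<theta> > B" for \<theta>
    proof -
      have t0: "\<theta> > 0" and lt: "\<And>j. b j < \<theta>" using that B0 le_B by (auto intro: le_less_trans)
      have law: "has_prob_fun w (kern (1 / \<theta>)) (P_theta b \<theta>)"
        unfolding w_def using t0 lt by (intro P_theta_law) (auto intro: less_imp_le)
      then have "P_theta b \<theta> \<in> laws w" and eq: "prob_fun w (P_theta b \<theta>) = kern (1 / \<theta>)"
        by (auto simp: has_prob_fun_def fun_eq_iff)
      moreover have "\<not> minimal (kern (1 / \<theta>))"
        using t0 lt by (intro not_minimal_kern[OF sm]) auto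
      ultimately show ?thesis unfolding w_def using extreme_laws_iff by auto
    qed
    have lim0: "b \<longlonglongrightarrow> 0" by (rule summable_LIMSEQ_zero[OF sm])
    \<comment> \<open>Used with \<open>c = b 0\<close>: records and maximizers satisfy
      \<open>b m \<ge> b 0\<close>, so there are finitely many records and the supremum is
      attained.\<close>
    have fin: "finite {m. c \<le> b m}" if c: "c > 0" for c
    proof -
      obtain N where "\<And>n. n \<ge> N \<Longrightarrow> b n < c"
        using order_tendstoD(2)[OF lim0 c] by (auto simp: eventually_sequentially)
      then have "{m. c \<le> b m} \<subseteq> {..<N}" by (force simp: not_le[symmetric])
      then show ?thesis using finite_subset by blast
    qed
    define R where "R = {m. \<forall>j<m. b m > b j}"
    have "R \<subseteq> {m. b 0 \<le> b m}"
      by (auto simp: R_def)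
    then have finR: "finite R" using fin[OF b_pos] finite_subset by blast
    obtain m0 where m0: "b m0 = B"
    proof -
      let ?A = "{m. b 0 \<le> b m}"
      have A: "finite ?A" "?A \<noteq> {}" using fin[OF b_pos] by auto
      then obtain m where m: "m \<in> ?A" "\<And>j. j \<in> ?A \<Longrightarrow> b j \<le> b m"
        using finite_imageI[of ?A b] Max_in[of "b ` ?A"] Max_ge[of "b ` ?A"] by fastforce
      have "b j \<le> b m" for j using m(1) m(2)[of j] by (cases "b 0 \<le> b j") auto
      then have "b m = B" using B_le[of "b m"] le_B[of m] by (simp add: antisym)
      then show ?thesis by (rule that)
    qed
    have ext: "extreme_laws w = {Q_left w m | m. \<forall>j<m. b m > b j} \<union> {Q_right w m | m. True}"
      unfolding w_def by (rule extreme_summable[OF sm])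
    define f where "f k = 1 - b 0 / hsum_ratio k" for k
    \<comment> \<open>The value 1 belongs to \<open>Q_right w 0\<close>, the others to the records;
      the remaining laws \<open>Q_right w (Suc k)\<close> give the sequence
      \<open>f\<close>.\<close>
    define F where "F = insert 1 ((\<lambda>m. 1 - b 0 / b m) ` R)"
    have fR: "first_head (Q_left w m) = 1 - b 0 / b m" if "m \<in> R" for m
      using first_head_law[OF Q_left_law[of m]] that by (simp add: R_def w_def)
    have f0: "first_head (Q_right w 0) = 1"
      using first_head_law[OF Q_right_law[OF sm, of 0]] Q_0_1(1)[OF sm] by (simp add: w_def)
    have fS: "first_head (Q_right w (Suc k)) = f k" for k
      using first_head_law[OF Q_right_law[OF sm, of "Suc k"]] Q_0_1(2)[OF sm, of k] by (simp add: w_def f_def)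
    have "E \<subseteq> F \<union> range f"
    proof
      fix x assume "x \<in> E"
      then obtain P where P: "P \<in> extreme_laws w" "x = first_head P" by (auto simp: E_def)
      from P(1)[unfolded ext] consider m where "P = Q_left w m" "m \<in> R" | m where "P = Q_right w m"
        by (auto simp: R_def)
      then show "x \<in> F \<union> range f"
      proof cases
        case (1 m)
        then show ?thesis unfolding F_def using P(2) fR by blast
      next
        case (2 m)
        then show ?thesis using P(2) f0 fS by (cases m) (auto simp: F_def)
      qed
    qed
    moreover have "range f \<subseteq> E"
    proof
      fix x assume "x \<in> range f"
      then obtain k where "x = first_head (Q_right w (Suc k))" using fS by auto
      moreover have "Q_right w (Suc k) \<in> extreme_laws w" unfolding ext by blast
      ultimately show "x \<in> E" unfolding E_def by blast
    qed
    moreover have "f \<longlonglongrightarrow> 1 - b 0 / B"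
      unfolding f_def using B0 le_B m0 by (intro tendsto_intros hsum_ratio_tendsto[OF sm, of B m0]) auto
    moreover have "f n \<noteq> 1 - b 0 / B" for n
      using hsum_ratio_gt[OF sm, of m0 n] b_pos[of 0] B0 by (simp add: f_def m0 frac_eq_eq)
    moreover have "finite F" using finR by (simp add: F_def)
    ultimately have lim: "x islimpt E \<longleftrightarrow> x = 1 - b 0 / B" for x
      by (intro islimpt_sequence_Un_finite[of f _ F])
    \<comment> \<open>The limit point has to be left out because it lies in \<open>E\<close> itself:
      the first index at which \<open>b\<close> is maximal is a record with this value.\<close>
    have "x isolated_in E" if "x \<in> E - {1 - b 0 / B}" for x
      using that lim by (simp add: isolated_in_islimpt_iff)
    moreover have "\<exists>!P. is_Q_right w m P" for m unfolding w_def by (rule ex1_Q_right[OF sm])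
    ultimately show ?thesis using theta not_ext Ql ext lim by (simp add: less_imp_le)
  qed
  have nsumm: "(\<forall>\<theta>\<ge>B. \<exists>!P. has_prob_fun w (phi_theta b \<theta>) P) \<and>
           (\<exists>!P. has_prob_fun w phi_inf P) \<and>
           (\<forall>m. (\<forall>j<m. b m > b j) \<longrightarrow> (\<exists>!P. is_Q_left w m P)) \<and>
           extreme_laws w = {Q_left w m | m. \<forall>j<m. b m > b j} \<union>
             ({P_theta b \<theta> | \<theta>. \<theta> > B} \<union> {P_theta b B, P_inf b}) \<and>
           {1 - b 0 / B .. 1} \<subseteq> E" if ns: "\<not> summable b"
  proof -
    have ext: "extreme_laws w = {Q_left w m | m. \<forall>j<m. b m > b j} \<union>
             ({P_theta b \<theta> | \<theta>. \<theta> > B} \<union> {P_theta b B, P_inf b})"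
      unfolding w_def using ns le_B B_le by (rule extreme_not_summable)
    have "{1 - b 0 / B .. 1} \<subseteq> E"
    proof
      fix x assume x: "x \<in> {1 - b 0 / B .. 1}"
      show "x \<in> E"
      proof (cases "x = 1")
        case True
        have "first_head (P_inf b) = 1" using first_head_law[OF P_inf_law] by simp
        moreover have "P_inf b \<in> extreme_laws w" unfolding ext by blast
        ultimately show ?thesis unfolding E_def True by (metis imageI)
      next
        case False
        then have x1: "x < 1" using x by simp
        \<comment> \<open>The solution of \<open>1 - b 0 / \<theta> = x\<close>; the lower end of
          the interval corresponds to \<open>\<theta> = B\<close>.\<close>
        define \<theta> where "\<theta> = b 0 / (1 - x)"
        have "\<theta> \<ge> B" using x x1 B0 by (simp add: \<theta>_def field_simps)
        then have t0: "\<theta> > 0" "\<And>j. b j \<le> \<theta>" using B0 le_B by (auto intro: order_trans)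
        have "first_head (P_theta b \<theta>) = 1 - b 0 / \<theta>"
          using first_head_law[OF P_theta_law[OF t0]] by simp
        also have "\<dots> = x" using x1 b_pos[of 0] by (simp add: \<theta>_def)
        finally have "first_head (P_theta b \<theta>) = x" .
        moreover have "P_theta b \<theta> \<in> extreme_laws w"
          unfolding ext using \<open>\<theta> \<ge> B\<close> by (cases "\<theta> = B") auto
        ultimately show ?thesis unfolding E_def by blast
      qed
    qed
    moreover have "\<exists>!P. has_prob_fun w phi_inf P" unfolding w_def by (rule ex1_inf)
    ultimately show ?thesis using theta Ql ext by simp
  qed
  from summ nsumm show ?thesis by blast
qed

end
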